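(* Let $a\in\mathbb{D}$, write $a=|a|\omega$ with $|\omega|=1$, and let $T=\mathrm{Re}(\bar{\omega}S)=\frac12(\bar{\omega}S+\omega S^* )$. Then: 1. $$|I-\bar{a}S|^{-1}=\frac{1}{\sqrt{1+|a|^2}}\left(I+ \sum_{n=1}^\infty (2n-1)(2n-3)\cdots 1\, \Big(\frac{|a|}{1+|a|^2}\Big)^n T^n\right).$$ 2. $$|C_a|^{-1}=\sqrt{1-|a|^2}\,W_a\Big\{I+ \sum_{n=1}^\infty (2n-1)(2n-3)\cdots 1\, \Big(\frac{|a|}{1+|a|^2}\Big)^n T^n\Big\}W_a$$ $$=\sqrt{1-|a|^2}\left(I+ \sum_{n=1}^\infty (2n-1)(2n-3)\cdots 1\, \Big(\frac{|a|}{1+|a|^2}\Big)^n (W_aTW_a)^n\right).$$ 3. $$\rho_a=(I-\bar{a}S)\Big\{I+ \sum_{n=1}^\infty (2n-1)(2n-3)\cdots 1\, \Big(\frac{|a|}{1+|a|^2}\Big)^n T^n\Big\}W_a=\Big(\mu(I-\bar{a}S)\Big)W_a.$$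
   Context: $\mathbb{D}$ is the open unit disk and $H^2=H^2(\mathbb{D})$ the Hardy space; $S$ is the shift $Sf(z)=zf(z)$ on $H^2$. For $a\in\mathbb{D}$, $\varphi_a(z)=\frac{a-z}{1-\bar a z}$ and $C_a:H^2\to H^2$, $C_af=f\circ\varphi_a$, is bounded with $C_a^2=I$. For a bounded operator $A$, $|A|=(A^*A)^{1/2}$, $\mathrm{Re}A=\frac12(A+A^* )$, and $\mu(A)$ is the unitary part in the polar decomposition $A=\mu(A)|A|$. $\rho_a=C_a(C_a^*C_a)^{-1/2}$ is the unitary part in the polar decomposition of $C_a$. $W_a$ is the selfadjoint unitary operator on $H^2$ given by $W_af(z)=\frac{\sqrt{1-|a|^2}}{1-\bar a z}f(\varphi_a(z))$.
   Formalization: Coefficients (2n-1)(2n-3)...1 are divided by n! throughout (the printed series diverge for a≠0), and a missing factor 1/sqrt(1+|a|^2) is inserted in both formulas of part 2 and the first formula of part 3. *)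

theory Defs
  imports "HOL-Complex_Analysis.Complex_Analysis"
begin

section \<open>The Hardy space of the disk\<close>

definition taylor :: "(complex \<Rightarrow> complex) \<Rightarrow> nat \<Rightarrow> complex" where
  "taylor f n = (deriv ^^ n) f 0 / fact n"

lemma taylor_add:
  assumes "f holomorphic_on ball 0 1" "g holomorphic_on ball 0 1"
  shows "taylor (\<lambda>z. f z + g z) n = taylor f n + taylor g n"
  using higher_deriv_add[OF assms, of 0 n] by (simp add: taylor_def add_divide_distrib)

lemma taylor_cmult:
  assumes "f holomorphic_on ball 0 1"
  shows "taylor (\<lambda>z. c * f z) n = c * taylor f n"
  using higher_deriv_cmult[OF assms, of 0 n c] by (simp add: taylor_def)

lemma taylor_zero [simp]: "taylor (\<lambda>z. 0) n = 0"
  by (simp add: taylor_def)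

lemma summable_norm_sq_add:
  fixes x y :: "nat \<Rightarrow> complex"
  assumes "summable (\<lambda>n. (norm (x n))\<^sup>2)" "summable (\<lambda>n. (norm (y n))\<^sup>2)"
  shows "summable (\<lambda>n. (norm (x n + y n))\<^sup>2)"
proof (rule summable_comparison_test')
  show "summable (\<lambda>n. 2 * (norm (x n))\<^sup>2 + 2 * (norm (y n))\<^sup>2)"
    using assms by (intro summable_add summable_mult)
  fix n :: nat
  have "(norm (x n + y n))\<^sup>2 \<le> (norm (x n) + norm (y n))\<^sup>2"
    by (simp add: norm_triangle_ineq power_mono)
  also have "\<dots> \<le> 2 * (norm (x n))\<^sup>2 + 2 * (norm (y n))\<^sup>2"
    using sum_squares_bound[of "norm (x n)" "norm (y n)"] by (simp add: power2_sum)
  finally show "norm ((norm (x n + y n))\<^sup>2) \<le> 2 * (norm (x n))\<^sup>2 + 2 * (norm (y n))\<^sup>2"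
    by simp
qed

lemma summable_mult_cnj:
  fixes x y :: "nat \<Rightarrow> complex"
  assumes "summable (\<lambda>n. (norm (x n))\<^sup>2)" "summable (\<lambda>n. (norm (y n))\<^sup>2)"
  shows "summable (\<lambda>n. x n * cnj (y n))"
proof (rule summable_comparison_test')
  show "summable (\<lambda>n. (norm (x n))\<^sup>2 + (norm (y n))\<^sup>2)"
    using assms by (intro summable_add)
  fix n :: nat
  have "2 * (norm (x n) * norm (y n)) \<le> (norm (x n))\<^sup>2 + (norm (y n))\<^sup>2"
    using sum_squares_bound[of "norm (x n)" "norm (y n)"] by simp
  moreover have "0 \<le> norm (x n) * norm (y n)" by simp
  ultimately have "norm (x n) * norm (y n) \<le> (norm (x n))\<^sup>2 + (norm (y n))\<^sup>2"
    by linarith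
  then show "norm (x n * cnj (y n)) \<le> (norm (x n))\<^sup>2 + (norm (y n))\<^sup>2"
    by (simp add: norm_mult)
qed

text \<open>Elements are holomorphic functions on the open unit disk with square-summable Taylor
  coefficients. To make them determined by their values on the disk, they are set to 0 off it.\<close>

typedef hardy = "{f :: complex \<Rightarrow> complex.
    f holomorphic_on ball 0 1 \<and> (\<forall>z. z \<notin> ball 0 1 \<longrightarrow> f z = 0) \<and>
    summable (\<lambda>n. (norm (taylor f n))\<^sup>2)}"
  morphisms hfun Abs_hardy
  by (rule exI[of _ "\<lambda>z. 0"]) simp

setup_lifting type_definition_hardy

lemma hfun_holo: "hfun f holomorphic_on ball 0 1"
  and hfun_off: "z \<notin> ball 0 1 \<Longrightarrow> hfun f z = 0"
  and hfun_summable: "summable (\<lambda>n. (norm (taylor (hfun f) n))\<^sup>2)"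
  using hfun[of f] by auto

text \<open>The element of the Hardy space given on the disk by the formula \<open>F\<close>; meaningful when
  \<open>F\<close> is holomorphic on the disk with square-summable Taylor coefficients.\<close>

definition hardy_of :: "(complex \<Rightarrow> complex) \<Rightarrow> hardy" where
  "hardy_of F = Abs_hardy (\<lambda>z. if z \<in> ball 0 1 then F z else 0)"

lift_definition cscale :: "complex \<Rightarrow> hardy \<Rightarrow> hardy" (infixr "*\<^sub>C" 75)
  is "\<lambda>c f z. c * f z"
  by (auto intro: holomorphic_intros simp: taylor_cmult norm_mult power_mult_distrib
      intro!: summable_mult)

definition cinner :: "hardy \<Rightarrow> hardy \<Rightarrow> complex" where
  "cinner f g = (\<Sum>n. taylor (hfun f) n * cnj (taylor (hfun g) n))"

instantiation hardy :: real_inner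
begin

lift_definition zero_hardy :: hardy is "\<lambda>z. 0"
  by simp

lift_definition plus_hardy :: "hardy \<Rightarrow> hardy \<Rightarrow> hardy" is "\<lambda>f g z. f z + g z"
  by (auto intro: holomorphic_intros simp: taylor_add summable_norm_sq_add)

definition uminus_hardy :: "hardy \<Rightarrow> hardy" where
  "- f = (-1) *\<^sub>C f"

definition minus_hardy :: "hardy \<Rightarrow> hardy \<Rightarrow> hardy" where
  "f - g = f + (- g :: hardy)"

definition scaleR_hardy :: "real \<Rightarrow> hardy \<Rightarrow> hardy" where
  "r *\<^sub>R f = complex_of_real r *\<^sub>C f"

definition inner_hardy :: "hardy \<Rightarrow> hardy \<Rightarrow> real" where
  "inner f g = Re (cinner f g)"

definition norm_hardy :: "hardy \<Rightarrow> real" where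
  "norm f = sqrt (inner f (f :: hardy))"

definition dist_hardy :: "hardy \<Rightarrow> hardy \<Rightarrow> real" where
  "dist f g = norm (f - g :: hardy)"

definition sgn_hardy :: "hardy \<Rightarrow> hardy" where
  "sgn f = inverse (norm f) *\<^sub>R (f :: hardy)"

definition uniformity_hardy :: "(hardy \<times> hardy) filter" where
  "uniformity_hardy = (INF e\<in>{0<..}. principal {(x, y :: hardy). dist x y < e})"

definition open_hardy :: "hardy set \<Rightarrow> bool" where
  "open_hardy U = (\<forall>x\<in>U. eventually (\<lambda>(x', y). x' = x \<longrightarrow> y \<in> U) uniformity)"

instance
proof
  have pl: "taylor (hfun (f + g)) n = taylor (hfun f) n + taylor (hfun g) n" for f g n
    by (simp add: plus_hardy.rep_eq taylor_add hfun_holo)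
  have sc: "taylor (hfun (c *\<^sub>C f)) n = c * taylor (hfun f) n" for c f n
    by (simp add: cscale.rep_eq taylor_cmult hfun_holo)
  have sm: "summable (\<lambda>n. taylor (hfun f) n * cnj (taylor (hfun g) n))" for f g
    by (intro summable_mult_cnj hfun_summable)
  have Re_sums: "(\<lambda>n. Re (taylor (hfun f) n * cnj (taylor (hfun g) n))) sums inner f g" for f g
    unfolding inner_hardy_def cinner_def by (intro sums_Re summable_sums sm)
  have sq: "(\<lambda>n. (norm (taylor (hfun f) n))\<^sup>2) sums inner f f" for f
    using Re_sums[of f f] by (simp only: complex_norm_square[symmetric] Re_complex_of_real)
  fix x y z :: hardy and a b :: real
  show "x + y + z = x + (y + z)" by transfer (simp add: add.assoc)
  show "x + y = y + x" by transfer (simp add: add.commute)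
  show "0 + x = x" by transfer simp
  show "- x + x = 0" unfolding uminus_hardy_def by transfer simp
  show "x - y = x + - y" by (simp add: minus_hardy_def)
  show "a *\<^sub>R (x + y) = a *\<^sub>R x + a *\<^sub>R y"
    unfolding scaleR_hardy_def by transfer (simp add: algebra_simps)
  show "(a + b) *\<^sub>R x = a *\<^sub>R x + b *\<^sub>R x"
    unfolding scaleR_hardy_def by transfer (simp add: algebra_simps)
  show "a *\<^sub>R b *\<^sub>R x = (a * b) *\<^sub>R x"
    unfolding scaleR_hardy_def by transfer (simp add: algebra_simps)
  show "1 *\<^sub>R x = x" unfolding scaleR_hardy_def by transfer simp
  show "dist x y = norm (x - y)" by (rule dist_hardy_def)
  show "sgn x = inverse (norm x) *\<^sub>R x" by (rule sgn_hardy_def)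
  show "uniformity = (INF e\<in>{0<..}. principal {(x, y :: hardy). dist x y < e})"
    by (rule uniformity_hardy_def)
  show "open U = (\<forall>x\<in>U. eventually (\<lambda>(x', y). x' = x \<longrightarrow> y \<in> U) uniformity)"
    for U :: "hardy set"
    by (simp add: open_hardy_def)
  show "inner x y = inner y x"
    using Re_sums[of x y] Re_sums[of y x] by (simp add: mult.commute sums_iff)
  show "inner (x + y) z = inner x z + inner y z"
    using sums_unique2[OF Re_sums[of "x + y" z]] sums_add[OF Re_sums[of x z] Re_sums[of y z]]
    by (simp add: pl algebra_simps)
  show "inner (a *\<^sub>R x) y = a * inner x y"
    using sums_unique2[OF Re_sums[of "a *\<^sub>R x" y]] sums_mult[OF Re_sums[of x y], of a]
    by (simp add: sc scaleR_hardy_def algebra_simps)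
  show nonneg: "0 \<le> inner x x"
    by (rule sums_le[OF _ sums_zero sq[of x]]) simp
  show "(inner x x = 0) = (x = 0)"
  proof
    assume "inner x x = 0"
    then have "(norm (taylor (hfun x) n))\<^sup>2 = 0" for n
      using suminf_eq_zero_iff[OF hfun_summable[of x]] sq[of x] by (simp add: sums_iff)
    then have "(deriv ^^ n) (hfun x) 0 = 0" for n
      by (simp add: taylor_def)
    then have "hfun x w = 0" if "w \<in> ball 0 1" for w
      using holomorphic_fun_eq_0_on_ball[OF hfun_holo that] by blast
    then have "hfun x = (\<lambda>z. 0)"
      using hfun_off by blast
    then show "x = 0"
      by (simp add: hfun_inject[symmetric] zero_hardy.rep_eq)
  next
    assume "x = 0"
    then show "inner x x = 0"
      using sq[of x] by (simp add: zero_hardy.rep_eq sums_iff)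
  qed
  show "norm x = sqrt (inner x x)" by (rule norm_hardy_def)
qed

end

lemma norm_cscale: "norm (c *\<^sub>C f) = norm c * norm f"
proof -
  have "taylor (hfun (c *\<^sub>C f)) n * cnj (taylor (hfun (c *\<^sub>C f)) n)
      = complex_of_real ((norm c)\<^sup>2) * (taylor (hfun f) n * cnj (taylor (hfun f) n))" for n
    by (simp add: cscale.rep_eq taylor_cmult hfun_holo complex_norm_square algebra_simps
        del: of_real_power)
  then have "cinner (c *\<^sub>C f) (c *\<^sub>C f) = complex_of_real ((norm c)\<^sup>2) * cinner f f"
    unfolding cinner_def by (simp only: suminf_mult[OF summable_mult_cnj[OF hfun_summable hfun_summable]])
  then have "inner (c *\<^sub>C f) (c *\<^sub>C f) = (norm c)\<^sup>2 * inner f f"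
    by (simp add: inner_hardy_def del: of_real_power)
  then show ?thesis
    by (simp add: norm_hardy_def real_sqrt_mult)
qed

lemma bounded_linear_cscale: "bounded_linear (cscale c)"
proof (rule bounded_linear_intro)
  show "c *\<^sub>C (f + g) = c *\<^sub>C f + c *\<^sub>C g" for f g
    by transfer (simp add: algebra_simps)
  show "c *\<^sub>C (r *\<^sub>R f) = r *\<^sub>R (c *\<^sub>C f)" for r f
    unfolding scaleR_hardy_def by transfer (simp add: algebra_simps)
  show "norm (c *\<^sub>C f) \<le> norm f * norm c" for f
    by (simp add: norm_cscale)
qed


section \<open>Operators on the Hardy space\<close>

text \<open>The type \<open>hardy \<Rightarrow>\<^sub>L hardy\<close> consists of the bounded \<^emph>\<open>real\<close>-linear maps, with the operator
  norm. Complex linearity is a separate condition; it has to be imposed where the remaining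
  conditions of a definition do not force it.\<close>

type_synonym hop = "hardy \<Rightarrow>\<^sub>L hardy"

definition clinear_op :: "hop \<Rightarrow> bool" where
  "clinear_op A \<longleftrightarrow> (\<forall>c f. A (c *\<^sub>C f) = c *\<^sub>C A f)"

definition op_scale :: "complex \<Rightarrow> hop \<Rightarrow> hop" where
  "op_scale c A = Blinfun (cscale c) o\<^sub>L A"

lemma op_scale_apply [simp]: "op_scale c A f = c *\<^sub>C A f"
  by (simp only: op_scale_def blinfun_apply_blinfun_compose
      bounded_linear_Blinfun_apply[OF bounded_linear_cscale])

primrec op_pow :: "hop \<Rightarrow> nat \<Rightarrow> hop" where
  "op_pow A 0 = id_blinfun"
| "op_pow A (Suc n) = A o\<^sub>L op_pow A n"

definition invertible_op :: "hop \<Rightarrow> bool" where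
  "invertible_op A \<longleftrightarrow> (\<exists>B. A o\<^sub>L B = id_blinfun \<and> B o\<^sub>L A = id_blinfun)"

definition op_inv :: "hop \<Rightarrow> hop" where
  "op_inv A = (THE B. A o\<^sub>L B = id_blinfun \<and> B o\<^sub>L A = id_blinfun)"

definition adj :: "hop \<Rightarrow> hop" where
  "adj A = (THE B :: hop. \<forall>f g. cinner (A f) g = cinner f (B g))"

definition op_Re :: "hop \<Rightarrow> hop" where
  "op_Re A = (1/2) *\<^sub>R (A + adj A)"

definition positive_op :: "hop \<Rightarrow> bool" where
  "positive_op P \<longleftrightarrow> clinear_op P \<and> (\<forall>f. cinner (P f) f \<in> \<real> \<and> 0 \<le> Re (cinner (P f) f))"

definition op_sqrt :: "hop \<Rightarrow> hop" where
  "op_sqrt B = (THE P. positive_op P \<and> P o\<^sub>L P = B)"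

definition op_abs :: "hop \<Rightarrow> hop" where
  "op_abs A = op_sqrt (adj A o\<^sub>L A)"

definition partial_isometry :: "hop \<Rightarrow> bool" where
  "partial_isometry U \<longleftrightarrow> clinear_op U \<and>
     (\<forall>f. (\<forall>g. U g = 0 \<longrightarrow> cinner f g = 0) \<longrightarrow> norm (U f) = norm f)"

text \<open>\<open>\<mu>(A)\<close>: the partially isometric factor of the polar decomposition, normalised by
  \<open>ker \<mu>(A) = ker A\<close>. It is unitary when \<open>A\<close> is invertible.\<close>

definition polar_part :: "hop \<Rightarrow> hop" where
  "polar_part A = (THE U. partial_isometry U \<and> (\<forall>f. U f = 0 \<longleftrightarrow> A f = 0) \<and> A = U o\<^sub>L op_abs A)"


section \<open>The shift, composition with a disk automorphism, and related operators\<close>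

text \<open>The maps passed to \<open>Blinfun\<close> below are bounded on the Hardy space (for \<open>\<bar>a\<bar> < 1\<close>).\<close>

definition shift :: hop where
  "shift = Blinfun (\<lambda>f. hardy_of (\<lambda>z. z * hfun f z))"

definition disk_aut :: "complex \<Rightarrow> complex \<Rightarrow> complex" where
  "disk_aut a z = (a - z) / (1 - cnj a * z)"

definition comp_op :: "complex \<Rightarrow> hop" where
  "comp_op a = Blinfun (\<lambda>f. hardy_of (\<lambda>z. hfun f (disk_aut a z)))"

definition W_op :: "complex \<Rightarrow> hop" where
  "W_op a = Blinfun (\<lambda>f. hardy_of
     (\<lambda>z. complex_of_real (sqrt (1 - (norm a)\<^sup>2)) / (1 - cnj a * z) * hfun f (disk_aut a z)))"

definition rho :: "complex \<Rightarrow> hop" where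
  "rho a = comp_op a o\<^sub>L op_inv (op_sqrt (adj (comp_op a) o\<^sub>L comp_op a))"

text \<open>The terms, for \<open>n \<ge> 1\<close>, of the binomial series of \<open>(I - 2 r A)\<^sup>-\<^sup>1\<^sup>/\<^sup>2\<close>. The coefficient is
  \<open>(2n-1)(2n-3)\<cdots>1 / n!\<close>; the factor \<open>1/n!\<close> is missing in the source, where the series as
  printed diverges for every \<open>a \<noteq> 0\<close>.\<close>

definition series_term :: "real \<Rightarrow> hop \<Rightarrow> nat \<Rightarrow> hop" where
  "series_term r A n = ((\<Prod>k=1..n. real (2 * k - 1)) / fact n * r ^ n) *\<^sub>R op_pow A n"

end

theory Submission
  imports Defs
begin

text \<open>
  Write \<open>X = - 2 r T\<close>. Since \<open>S\<^sup>*S = I\<close>, the operator \<open>L = I - cnj a S\<close> satisfies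
  \<open>L\<^sup>*L = (1 + \<bar>a\<bar>\<^sup>2) I - (cnj a S + a S\<^sup>*) = (1 + \<bar>a\<bar>\<^sup>2) (I + X)\<close>, and
  \<open>\<parallel>X\<parallel> \<le> 2 \<bar>a\<bar> / (1 + \<bar>a\<bar>\<^sup>2) < 1\<close>. So \<open>\<bar>L\<bar>\<close> and its inverse are the binomial series
  \<open>(I + X)\<^sup>\<alpha> = \<Sum>n. (\<alpha> gchoose n) X\<^sup>n\<close> with \<open>\<alpha> = 1/2\<close> and \<open>\<alpha> = -1/2\<close>, up to the scalar
  \<open>sqrt (1 + \<bar>a\<bar>\<^sup>2)\<close>. Comparing the functions on the disk gives
  \<open>C\<^sub>a = (1 - \<bar>a\<bar>\<^sup>2)\<^sup>-\<^sup>1\<^sup>/\<^sup>2 L W\<close>, where \<open>W = W\<^sub>a\<close> is a selfadjoint unitary; hence \<open>C\<^sub>a\<^sup>*C\<^sub>a\<close> is, up to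
  a scalar, \<open>I + W X W\<close>. The same series applies to \<open>W X W\<close>, and it is the conjugate by \<open>W\<close>
  of the series for \<open>X\<close>. The formulas for \<open>\<rho>\<^sub>a\<close> and \<open>\<mu>(L) = L \<bar>L\<bar>\<^sup>-\<^sup>1\<close> follow by multiplication.

  Three facts carry this argument.

  \<^item> Powers multiply: \<open>(I + X)\<^sup>\<alpha> (I + X)\<^sup>\<beta> = (I + X)\<^sup>\<alpha>\<^sup>+\<^sup>\<beta>\<close> for \<open>\<parallel>X\<parallel> < 1\<close>
    (\<open>op_binomial_mult\<close>), by Vandermonde's identity and the Cauchy product. The series converge in
    operator norm because the Hardy space is complete.

  \<^item> The positive square root is unique (\<open>op_sqrt_affine\<close>). The series \<open>P = (I + X)\<^sup>1\<^sup>/\<^sup>2\<close> is positive and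
    injective, being the square of the selfadjoint invertible operator \<open>(I + X)\<^sup>1\<^sup>/\<^sup>4\<close>. Another
    positive square root \<open>Q\<close> commutes with \<open>X = Q\<^sup>2 - I\<close>, hence with \<open>P\<close>, so
    \<open>(P + Q) (P - Q) = 0\<close>; and \<open>P + Q\<close> is injective since \<open>P\<close> is strictly positive.

  \<^item> \<open>W\<^sub>a\<close> maps the Hardy space isometrically into itself (\<open>weighted_composition_exists\<close>). It sends
    \<open>z\<^sup>n\<close> to \<open>M\<^sup>n e\<^sub>0\<close>, where \<open>M = (a - S) (I - cnj a S)\<^sup>-\<^sup>1\<close> is multiplication by the disk
    automorphism and \<open>e\<^sub>0\<close> is the normalised reproducing kernel at \<open>a\<close>. Since \<open>M\<close> is an isometry
    and functions in its range vanish at \<open>a\<close>, these vectors are orthonormal.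
\<close>


section \<open>Taylor coefficients and completeness\<close>

definition hcoeff :: "hardy \<Rightarrow> nat \<Rightarrow> complex" where
  "hcoeff f n = taylor (hfun f) n"

lemma hcoeff_add [simp]: "hcoeff (f + g) n = hcoeff f n + hcoeff g n"
  by (simp add: hcoeff_def plus_hardy.rep_eq taylor_add hfun_holo)

lemma hcoeff_cscale [simp]: "hcoeff (c *\<^sub>C f) n = c * hcoeff f n"
  by (simp add: hcoeff_def cscale.rep_eq taylor_cmult hfun_holo)

lemma hcoeff_scaleR [simp]: "hcoeff (r *\<^sub>R f) n = of_real r * hcoeff f n"
  by (simp add: scaleR_hardy_def)

lemma hcoeff_uminus [simp]: "hcoeff (- f) n = - hcoeff f n"
  by (simp add: uminus_hardy_def)

lemma hcoeff_diff [simp]: "hcoeff (f - g) n = hcoeff f n - hcoeff g n"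
  by (simp only: minus_hardy_def hcoeff_add hcoeff_uminus) simp

lemma summable_hcoeff: "summable (\<lambda>n. (norm (hcoeff f n))\<^sup>2)"
  using hfun_summable[of f] by (simp add: hcoeff_def)

lemma hfun_add [simp]: "hfun (f + g) z = hfun f z + hfun g z"
  by (simp add: plus_hardy.rep_eq)

lemma hfun_cscale [simp]: "hfun (c *\<^sub>C f) z = c * hfun f z"
  by (simp add: cscale.rep_eq)

lemma hfun_scaleR [simp]: "hfun (r *\<^sub>R f) z = of_real r * hfun f z"
  by (simp add: scaleR_hardy_def)

lemma hfun_diff [simp]: "hfun (f - g) z = hfun f z - hfun g z"
  by (simp only: minus_hardy_def uminus_hardy_def hfun_add hfun_cscale) simp

lemma hfun_sums: "(\<lambda>n. hcoeff f n * z ^ n) sums hfun f z" if "norm z < 1"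
  using holomorphic_power_series[OF hfun_holo, of z f] that by (simp add: hcoeff_def taylor_def)

lemma hardy_eqI_fun: "f = g" if "\<And>z. norm z < 1 \<Longrightarrow> hfun f z = hfun g z"
proof -
  have "hfun f z = hfun g z" for z
    using that[of z] hfun_off[of z f] hfun_off[of z g] by (cases "norm z < 1") auto
  then show ?thesis by (simp add: hfun_inject[symmetric] fun_eq_iff)
qed

lemma hardy_eqI: "f = g" if "\<And>n. hcoeff f n = hcoeff g n"
proof (rule hardy_eqI_fun)
  fix z :: complex assume "norm z < 1"
  then show "hfun f z = hfun g z"
    using hfun_sums[of z f] hfun_sums[of z g] that by (simp add: sums_iff)
qed

lemma hardy_of_eqI: "hardy_of F = g" if "\<And>z. norm z < 1 \<Longrightarrow> hfun g z = F z"
proof -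
  have "(\<lambda>z. if z \<in> ball 0 1 then F z else 0) = hfun g"
    using that hfun_off[of _ g] by auto
  then show ?thesis by (simp add: hardy_of_def hfun_inverse)
qed

lemma powser_summable_if_square_summable:
  fixes x :: "nat \<Rightarrow> complex"
  assumes x: "summable (\<lambda>n. (norm (x n))\<^sup>2)" and z: "norm z < 1"
  shows "summable (\<lambda>n. x n * z ^ n)"
proof -
  have "Bseq (\<lambda>n. (norm (x n))\<^sup>2)"
    using x by (rule summable_imp_Bseq)
  then obtain C where C: "\<And>n. (norm (x n))\<^sup>2 \<le> C"
    unfolding Bseq_def by auto
  have "norm (x n * z ^ n) \<le> sqrt C * norm z ^ n" for n
    using C[of n] by (simp add: norm_mult norm_power mult_right_mono real_le_rsqrt)
  moreover have "summable (\<lambda>n. sqrt C * norm z ^ n)"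
    using z by (intro summable_mult summable_geometric) simp
  ultimately show ?thesis by (meson summable_comparison_test')
qed

text \<open>The Hardy space is all of \<open>\<ell>\<^sup>2\<close>: a square-summable sequence is bounded, so its power series
  converges on the disk, and its sum has these Taylor coefficients.\<close>

lemma hardy_of_coeffs_exists:
  assumes x: "summable (\<lambda>n. (norm (x n :: complex))\<^sup>2)"
  shows "\<exists>f. \<forall>n. hcoeff f n = x n"
proof -
  define F where "F = (\<lambda>z. \<Sum>n. x n * z ^ n)"
  have sums: "(\<lambda>n. x n * z ^ n) sums F z" if "norm z < 1" for z
    using powser_summable_if_square_summable[OF x that] by (simp add: F_def summable_sums)
  define G where "G = (\<lambda>z. if z \<in> ball 0 1 then F z else 0)"
  have sumsG: "(\<lambda>n. x n * z ^ n) sums G z" if "norm z < 1" for z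
    using sums[OF that] that by (simp add: G_def)
  have holo: "G holomorphic_on ball 0 1"
    by (rule power_series_holomorphic[where a = x]) (use sumsG in simp)
  have "eventually (\<lambda>z. z \<in> ball 0 1) (nhds (0::complex))"
    by (intro eventually_nhds_in_open) auto
  then have "eventually (\<lambda>z. (\<lambda>n. fps_nth (Abs_fps x) n * z ^ n) sums G z) (nhds 0)"
    by eventually_elim (use sumsG in simp)
  then have "G has_fps_expansion Abs_fps x"
    by (rule has_fps_expansionI)
  then have co: "taylor G n = x n" for n
    using fps_nth_fps_expansion[of G "Abs_fps x" n] by (simp add: taylor_def)
  have "G \<in> {f. f holomorphic_on ball 0 1 \<and> (\<forall>z. z \<notin> ball 0 1 \<longrightarrow> f z = 0) \<and>
    summable (\<lambda>n. (norm (taylor f n))\<^sup>2)}"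
    using holo x by (simp add: co) (simp add: G_def)
  then have "hfun (Abs_hardy G) = G" by (rule Abs_hardy_inverse)
  then show ?thesis by (intro exI[of _ "Abs_hardy G"]) (simp add: hcoeff_def co)
qed

definition of_coeffs :: "(nat \<Rightarrow> complex) \<Rightarrow> hardy" where
  "of_coeffs x = (SOME f. \<forall>n. hcoeff f n = x n)"

lemma hcoeff_of_coeffs:
  assumes "summable (\<lambda>n. (norm (x n))\<^sup>2)"
  shows "hcoeff (of_coeffs x) n = x n"
  using someI_ex[OF hardy_of_coeffs_exists[OF assms]] by (simp add: of_coeffs_def)

lemma cinner_sums: "(\<lambda>n. hcoeff f n * cnj (hcoeff g n)) sums cinner f g"
  unfolding cinner_def hcoeff_def
  by (intro summable_sums summable_mult_cnj hfun_summable)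

lemma norm_sq_sums: "(\<lambda>n. (norm (hcoeff f n))\<^sup>2) sums (norm f)\<^sup>2"
proof -
  have "(\<lambda>n. Re (hcoeff f n * cnj (hcoeff f n))) sums Re (cinner f f)"
    by (intro sums_Re cinner_sums)
  moreover have "Re (cinner f f) = (norm f)\<^sup>2"
    using inner_hardy_def[of f f] by (simp add: power2_norm_eq_inner)
  ultimately show ?thesis
    by (simp only: complex_norm_square[symmetric] Re_complex_of_real)
qed

lemma norm_le_coeffs:
  assumes "\<And>N. (\<Sum>n<N. (norm (hcoeff f n))\<^sup>2) \<le> e\<^sup>2" "0 \<le> e"
  shows "norm f \<le> e"
proof (rule power2_le_imp_le)
  show "(norm f)\<^sup>2 \<le> e\<^sup>2"
    by (rule LIMSEQ_le_const2[OF norm_sq_sums[unfolded sums_def]]) (use assms(1) in blast)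
qed fact

lemma sum_hcoeff_le: "(\<Sum>n\<in>A. (norm (hcoeff f n))\<^sup>2) \<le> (norm f)\<^sup>2" if "finite A"
  using sum_le_suminf[OF summable_hcoeff that, of f] norm_sq_sums[of f] by (simp add: sums_iff)

lemma hcoeff_le: "norm (hcoeff f n) \<le> norm f"
  by (rule power2_le_imp_le) (use sum_hcoeff_le[of "{n}" f] in auto)

text \<open>The usual completeness proof for \<open>\<ell>\<^sup>2\<close>: coefficients converge pointwise, and the limit
  sequence is square-summable and close in norm because bounds on finite partial sums pass to
  the limit.\<close>

instance hardy :: banach
proof
  fix X :: "nat \<Rightarrow> hardy"
  assume X: "Cauchy X"
  have "Cauchy (\<lambda>m. hcoeff (X m) n)" for n
  proof (rule CauchyI)
    fix e :: real assume "0 < e"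
    from CauchyD[OF X this] obtain M where M: "\<forall>m\<ge>M. \<forall>k\<ge>M. norm (X m - X k) < e" ..
    have "norm (hcoeff (X m) n - hcoeff (X k) n) < e" if "m \<ge> M" "k \<ge> M" for m k
      using hcoeff_le[of "X m - X k" n] M that by (simp add: le_less_trans[of _ "norm (X m - X k)"])
    then show "\<exists>M. \<forall>m\<ge>M. \<forall>k\<ge>M. norm (hcoeff (X m) n - hcoeff (X k) n) < e" by blast
  qed
  then have "\<forall>n. \<exists>l. (\<lambda>m. hcoeff (X m) n) \<longlonglongrightarrow> l"
    using Cauchy_convergent convergent_def by blast
  then obtain x where x: "\<And>n. (\<lambda>m. hcoeff (X m) n) \<longlonglongrightarrow> x n" by metis
  have tail: "\<exists>M. \<forall>m\<ge>M. \<forall>N. (\<Sum>n<N. (norm (hcoeff (X m) n - x n))\<^sup>2) \<le> e\<^sup>2"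
    if "0 < e" for e
  proof -
    from CauchyD[OF X that] obtain M where M: "\<forall>m\<ge>M. \<forall>k\<ge>M. norm (X m - X k) < e" ..
    have "(\<Sum>n<N. (norm (hcoeff (X m) n - x n))\<^sup>2) \<le> e\<^sup>2" if m: "m \<ge> M" for m N
    proof (rule LIMSEQ_le_const2)
      show "(\<lambda>k. \<Sum>n<N. (norm (hcoeff (X m) n - hcoeff (X k) n))\<^sup>2)
          \<longlonglongrightarrow> (\<Sum>n<N. (norm (hcoeff (X m) n - x n))\<^sup>2)"
        by (intro tendsto_intros x)
      show "\<exists>K. \<forall>k\<ge>K. (\<Sum>n<N. (norm (hcoeff (X m) n - hcoeff (X k) n))\<^sup>2) \<le> e\<^sup>2"
      proof (intro exI[of _ M] allI impI)
        fix k assume "k \<ge> M"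
        then have "(norm (X m - X k))\<^sup>2 \<le> e\<^sup>2"
          using M m by (intro power_mono less_imp_le[of _ e]) simp_all
        then show "(\<Sum>n<N. (norm (hcoeff (X m) n - hcoeff (X k) n))\<^sup>2) \<le> e\<^sup>2"
          using sum_hcoeff_le[of "{..<N}" "X m - X k"] by simp
      qed
    qed
    then show ?thesis by blast
  qed
  obtain M where M: "\<And>N. (\<Sum>n<N. (norm (hcoeff (X M) n - x n))\<^sup>2) \<le> 1"
    using tail[OF zero_less_one] unfolding power_one by blast
  have "summable (\<lambda>n. (norm (hcoeff (X M) n - x n))\<^sup>2)"
    by (rule summableI_nonneg_bounded[where x = 1]) (use M in auto)
  then have "summable (\<lambda>n. (norm (x n - hcoeff (X M) n))\<^sup>2)"
    by (simp add: norm_minus_commute)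
  from summable_norm_sq_add[OF this summable_hcoeff[of "X M"]]
  have "summable (\<lambda>n. (norm (x n))\<^sup>2)" by simp
  from hardy_of_coeffs_exists[OF this] obtain f where f: "\<And>n. hcoeff f n = x n" by blast
  have "X \<longlonglongrightarrow> f"
  proof (rule LIMSEQ_I)
    fix e :: real assume e: "0 < e"
    then obtain M where M: "\<forall>m\<ge>M. \<forall>N. (\<Sum>n<N. (norm (hcoeff (X m) n - x n))\<^sup>2) \<le> (e/2)\<^sup>2"
      using tail[of "e/2"] by (meson half_gt_zero)
    have "norm (X m - f) < e" if "m \<ge> M" for m
    proof -
      have "norm (X m - f) \<le> e/2"
        by (rule norm_le_coeffs) (use M that e in \<open>simp_all add: f del: power_divide\<close>)
      then show ?thesis using e by simp
    qed
    then show "\<exists>M. \<forall>m\<ge>M. norm (X m - f) < e" by blast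
  qed
  then show "convergent X" by (rule convergentI)
qed


section \<open>The complex inner product and evaluation functionals\<close>

lemma cscale_simps [simp]:
  "c *\<^sub>C (f + g) = c *\<^sub>C f + c *\<^sub>C g" "c *\<^sub>C (f - g) = c *\<^sub>C f - c *\<^sub>C g"
  "c *\<^sub>C d *\<^sub>C f = (c * d) *\<^sub>C f" "1 *\<^sub>C f = f"
  by (simp_all add: hardy_eqI algebra_simps)

lemma scaleR_cscale: "r *\<^sub>R c *\<^sub>C f = c *\<^sub>C (r *\<^sub>R f)"
  by (rule hardy_eqI) simp

lemma Re_cinner: "Re (cinner f g) = inner f g"
  by (simp add: inner_hardy_def)

lemma cinner_cscale_left [simp]: "cinner (c *\<^sub>C f) g = c * cinner f g"
  by (rule sums_unique2[OF cinner_sums])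
    (use sums_mult[OF cinner_sums[of f g], of c] in \<open>simp add: mult.assoc\<close>)

lemma cinner_cscale_right [simp]: "cinner f (c *\<^sub>C g) = cnj c * cinner f g"
  by (rule sums_unique2[OF cinner_sums])
    (use sums_mult[OF cinner_sums[of f g], of "cnj c"] in \<open>simp add: mult_ac\<close>)

text \<open>Since the complex inner product is determined by the real one, it inherits the additivity and
  continuity of the latter.\<close>

lemma cinner_eq_inner: "cinner f g = Complex (inner f g) (inner f (\<i> *\<^sub>C g))"
  by (simp add: complex_eq_iff flip: Re_cinner)

lemma cinner_add_left [simp]: "cinner (f + g) h = cinner f h + cinner g h"
  and cinner_add_right [simp]: "cinner h (f + g) = cinner h f + cinner h g"
  and cinner_diff_left [simp]: "cinner (f - g) h = cinner f h - cinner g h"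
  and cinner_diff_right [simp]: "cinner h (f - g) = cinner h f - cinner h g"
  by (simp_all add: cinner_eq_inner complex_eq_iff inner_add_left inner_add_right
      inner_diff_left inner_diff_right)

lemma cinner_scaleR_left [simp]: "cinner (r *\<^sub>R f) h = r *\<^sub>R cinner f h"
  and cinner_scaleR_right [simp]: "cinner h (r *\<^sub>R f) = r *\<^sub>R cinner h f"
  by (simp_all add: scaleR_hardy_def scaleR_conv_of_real)

lemma cinner_zero_left [simp]: "cinner 0 h = 0"
  by (simp add: cinner_eq_inner complex_eq_iff)

lemma cinner_commute: "cinner f g = cnj (cinner g f)"
proof (rule sums_unique2[OF cinner_sums])
  show "(\<lambda>n. hcoeff f n * cnj (hcoeff g n)) sums cnj (cinner g f)"
    using cinner_sums[of g f] by (subst sums_cnj[symmetric]) (simp add: mult.commute)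
qed

lemma cinner_self: "cinner f f = of_real ((norm f)\<^sup>2)"
proof -
  have "Im (cinner f f) = 0"
    using cinner_commute[of f f] by (simp add: complex_eq_iff)
  moreover have "Re (cinner f f) = (norm f)\<^sup>2"
    by (simp add: Re_cinner power2_norm_eq_inner)
  ultimately show ?thesis by (simp add: complex_eq_iff)
qed

lemma bounded_linear_cinner_left: "bounded_linear (\<lambda>f. cinner f g)"
proof -
  have "(\<lambda>f. cinner f g) = (\<lambda>f. of_real (inner f g) + of_real (inner f (\<i> *\<^sub>C g)) * \<i>)"
    by (auto simp: cinner_eq_inner complex_eq_iff)
  then show ?thesis
    by (simp only:) (intro bounded_linear_add bounded_linear_mult_const
        bounded_linear_compose[OF bounded_linear_of_real bounded_linear_inner_left])
qed

lemma bounded_linear_cinner_right: "bounded_linear (\<lambda>f. cinner g f)"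
  using bounded_linear_compose[OF bounded_linear_cnj bounded_linear_cinner_left[of g]]
  by (simp flip: cinner_commute)

text \<open>The reproducing kernel of the Hardy space at \<open>a\<close>.\<close>

definition kernel :: "complex \<Rightarrow> hardy" where
  "kernel a = of_coeffs (\<lambda>n. cnj a ^ n)"

lemma hcoeff_kernel: "hcoeff (kernel a) n = cnj a ^ n" if "norm a < 1"
  unfolding kernel_def
proof (rule hcoeff_of_coeffs)
  have "(norm a)\<^sup>2 < 1" using that by (simp add: abs_square_less_1)
  then have "summable (\<lambda>n. ((norm a)\<^sup>2) ^ n)" by (intro summable_geometric) simp
  then show "summable (\<lambda>n. (norm (cnj a ^ n))\<^sup>2)"
    by (simp add: norm_power power_commutes flip: power_mult power2_eq_square) (simp add: mult.commute)
qed

lemma cinner_kernel: "cinner f (kernel a) = hfun f a" if "norm a < 1"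
  using cinner_sums[of f "kernel a"] hfun_sums[OF that, of f]
  by (simp add: hcoeff_kernel[OF that] sums_iff)

lemma hfun_kernel: "hfun (kernel a) z = 1 / (1 - cnj a * z)" if "norm a < 1" "norm z < 1"
proof -
  have "norm (cnj a * z) < 1"
    using mult_strict_mono'[of "norm a" 1 "norm z" 1] that by (simp add: norm_mult)
  then have "(\<lambda>n. (cnj a * z) ^ n) sums (1 / (1 - cnj a * z))"
    by (rule geometric_sums)
  then show ?thesis
    using hfun_sums[OF that(2), of "kernel a"]
    by (simp add: hcoeff_kernel[OF that(1)] power_mult_distrib sums_iff)
qed

lemma bounded_linear_hfun: "bounded_linear (\<lambda>f. hfun f z)" if "norm z < 1"
  using bounded_linear_cinner_left[of "kernel z"] by (simp add: cinner_kernel[OF that])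


section \<open>Complex-linear operators and adjoints\<close>

text \<open>A relation, in place of the description operator in \<open>adj\<close>, makes no claim that an adjoint
  exists; every adjoint below is exhibited explicitly.\<close>

definition is_adjoint :: "hop \<Rightarrow> hop \<Rightarrow> bool" where
  "is_adjoint A B \<longleftrightarrow> (\<forall>f g. cinner (A f) g = cinner f (B g))"

lemma is_adjointD: "is_adjoint A B \<Longrightarrow> cinner (A f) g = cinner f (B g)"
  by (simp add: is_adjoint_def)

lemma is_adjoint_sym: "is_adjoint A B \<Longrightarrow> is_adjoint B A"
  unfolding is_adjoint_def by (metis cinner_commute)

lemma adj_eqI: "is_adjoint A B \<Longrightarrow> adj A = B"
  unfolding adj_def
proof (rule the_equality)
  fix C :: hop assume "is_adjoint A B" and C: "\<forall>f g. cinner (A f) g = cinner f (C g)"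
  then have "cinner f (C g - B g) = 0" for f g
    by (simp add: is_adjoint_def)
  then have "C g - B g = 0" for g
    using cinner_self[of "C g - B g"] by (metis norm_eq_zero of_real_eq_0_iff zero_eq_power2)
  then show "C = B" by (intro blinfun_eqI[of C B]) simp
qed (simp add: is_adjoint_def)

lemma is_adjoint_id: "is_adjoint id_blinfun id_blinfun"
  by (simp add: is_adjoint_def)

lemma is_adjoint_add: "is_adjoint A B \<Longrightarrow> is_adjoint C D \<Longrightarrow> is_adjoint (A + C) (B + D)"
  by (simp add: is_adjoint_def blinfun.bilinear_simps)

lemma is_adjoint_diff: "is_adjoint A B \<Longrightarrow> is_adjoint C D \<Longrightarrow> is_adjoint (A - C) (B - D)"
  by (simp add: is_adjoint_def blinfun.bilinear_simps)

lemma is_adjoint_scaleR: "is_adjoint A B \<Longrightarrow> is_adjoint (r *\<^sub>R A) (r *\<^sub>R B)"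
  by (simp add: is_adjoint_def blinfun.bilinear_simps)

lemma is_adjoint_op_scale: "is_adjoint A B \<Longrightarrow> is_adjoint (op_scale c A) (op_scale (cnj c) B)"
  by (simp add: is_adjoint_def)

lemma is_adjoint_compose: "is_adjoint A B \<Longrightarrow> is_adjoint C D \<Longrightarrow> is_adjoint (A o\<^sub>L C) (D o\<^sub>L B)"
  by (simp add: is_adjoint_def)

lemma compose_assoc: "(A o\<^sub>L B) o\<^sub>L C = A o\<^sub>L (B o\<^sub>L C)"
  by (rule blinfun_eqI) simp

lemma compose_id [simp]: "A o\<^sub>L id_blinfun = A" "id_blinfun o\<^sub>L A = A"
  by (rule blinfun_eqI, simp)+

lemma op_pow_commute: "A o\<^sub>L B = B o\<^sub>L A \<Longrightarrow> op_pow A n o\<^sub>L B = B o\<^sub>L op_pow A n"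
proof (induction n)
  case (Suc n)
  then show ?case
    by (metis compose_assoc op_pow.simps(2))
qed simp

lemma op_pow_add: "op_pow A (m + n) = op_pow A m o\<^sub>L op_pow A n"
  by (induction m) (auto intro!: blinfun_eqI)

lemma is_adjoint_pow: "is_adjoint A A \<Longrightarrow> is_adjoint (op_pow A n) (op_pow A n)"
proof (induction n)
  case (Suc n)
  then show ?case
    using is_adjoint_compose[of A A "op_pow A n" "op_pow A n"] op_pow_commute[of A A n]
    by simp
qed (simp add: is_adjoint_id)

lemma clinear_id: "clinear_op id_blinfun"
  by (simp add: clinear_op_def)

lemma clinear_add: "clinear_op A \<Longrightarrow> clinear_op B \<Longrightarrow> clinear_op (A + B)"
  by (simp add: clinear_op_def blinfun.bilinear_simps)

lemma clinear_diff: "clinear_op A \<Longrightarrow> clinear_op B \<Longrightarrow> clinear_op (A - B)"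
  by (simp add: clinear_op_def blinfun.bilinear_simps)

lemma clinear_scaleR: "clinear_op A \<Longrightarrow> clinear_op (r *\<^sub>R A)"
  by (simp add: clinear_op_def blinfun.bilinear_simps scaleR_cscale)

lemma clinear_op_scale: "clinear_op A \<Longrightarrow> clinear_op (op_scale c A)"
  by (simp add: clinear_op_def mult.commute)

lemma clinear_compose: "clinear_op A \<Longrightarrow> clinear_op B \<Longrightarrow> clinear_op (A o\<^sub>L B)"
  by (simp add: clinear_op_def)

lemma clinear_pow: "clinear_op A \<Longrightarrow> clinear_op (op_pow A n)"
  by (induction n) (auto intro: clinear_id clinear_compose)

lemma isometry_inner:
  fixes U :: hop
  assumes "\<And>f. norm (U f) = norm f"
  shows "inner (U f) (U g) = inner f g"
  using assms[of "f + g"] by (simp add: dot_norm blinfun.bilinear_simps assms)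

lemma isometry_cinner:
  assumes "clinear_op U" "\<And>f. norm (U f) = norm f"
  shows "cinner (U f) (U g) = cinner f g"
  using isometry_inner[of U f g, OF assms(2)] isometry_inner[of U f "\<i> *\<^sub>C g", OF assms(2)] assms(1)
  by (simp add: cinner_eq_inner clinear_op_def)

lemma op_inv_eqI:
  assumes "A o\<^sub>L B = id_blinfun" "B o\<^sub>L A = id_blinfun"
  shows "op_inv A = B"
  unfolding op_inv_def
proof (rule the_equality)
  fix C assume C: "A o\<^sub>L C = id_blinfun \<and> C o\<^sub>L A = id_blinfun"
  then show "C = B" using assms by (metis compose_assoc compose_id)
qed (use assms in auto)


section \<open>The binomial series of an operator\<close>

lemma norm_op_pow_le: "norm (op_pow A n) \<le> norm A ^ n"
proof (induction n)
  case (Suc n)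
  have "norm (op_pow A (Suc n)) \<le> norm A * norm (op_pow A n)"
    by (simp add: norm_blinfun_compose)
  then show ?case using Suc mult_left_mono[OF Suc, of "norm A"] by simp
qed (simp add: norm_blinfun_id_le)

lemmas bounded_linear_compose_left =
  bounded_bilinear.bounded_linear_left[OF bounded_bilinear_blinfun_compose]
lemmas bounded_linear_compose_right =
  bounded_bilinear.bounded_linear_right[OF bounded_bilinear_blinfun_compose]

text \<open>The difference between the sums over the square \<open>i, j < n\<close> and over the triangle
  \<open>i + j < n\<close> is dominated in norm by the same difference for the real series of norms. The
  latter tends to 0 by the Cauchy product theorem for real numbers.\<close>

lemma Cauchy_product_blinfun_compose:
  fixes A B :: "nat \<Rightarrow> hop"
  assumes A: "summable (\<lambda>n. norm (A n))" and B: "summable (\<lambda>n. norm (B n))"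
  shows "(\<lambda>k. \<Sum>i\<le>k. A i o\<^sub>L B (k - i)) sums (suminf A o\<^sub>L suminf B)"
proof -
  let ?Q = "\<lambda>n. {..<n} \<times> {..<n}" and ?D = "\<lambda>n. {(i, j). i + j < (n::nat)}"
  let ?g = "\<lambda>(i, j). A i o\<^sub>L B j" and ?h = "\<lambda>(i, j). norm (A i) * norm (B j)"
  have fin: "finite (?Q n)" and sub: "?D n \<subseteq> ?Q n" for n by auto
  have square: "(\<lambda>n. sum ?g (?Q n)) \<longlonglongrightarrow> (suminf A o\<^sub>L suminf B)"
  proof -
    have "sum ?g (?Q n) = (\<Sum>i<n. A i) o\<^sub>L (\<Sum>j<n. B j)" for n
    proof -
      have "(\<Sum>i<n. A i) o\<^sub>L (\<Sum>j<n. B j) = (\<Sum>i<n. A i o\<^sub>L (\<Sum>j<n. B j))"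
        by (rule linear_sum[OF bounded_linear.linear[OF bounded_linear_compose_left]])
      then show ?thesis
        by (simp add: linear_sum[OF bounded_linear.linear[OF bounded_linear_compose_right]]
            sum.cartesian_product)
    qed
    then show ?thesis
      by (simp only:) (intro bounded_bilinear.tendsto[OF bounded_bilinear_blinfun_compose]
          summable_LIMSEQ summable_norm_cancel[OF A] summable_norm_cancel[OF B])
  qed
  have "(\<lambda>n. sum ?h (?Q n) - sum ?h (?D n)) \<longlonglongrightarrow> 0"
  proof -
    have "(\<lambda>n. (\<Sum>i<n. norm (A i)) * (\<Sum>j<n. norm (B j))
          - (\<Sum>k<n. \<Sum>i\<le>k. norm (A i) * norm (B (k - i))))
        \<longlonglongrightarrow> (\<Sum>i. norm (A i)) * (\<Sum>j. norm (B j)) - (\<Sum>i. norm (A i)) * (\<Sum>j. norm (B j))"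
      using Cauchy_product_sums[of "\<lambda>n. norm (A n)" "\<lambda>n. norm (B n)"] A B
      by (intro tendsto_intros summable_LIMSEQ) (auto simp: sums_def)
    then show ?thesis
      by (simp add: sum_product sum.cartesian_product sum.triangle_reindex)
  qed
  moreover have "norm (sum ?g (?Q n) - sum ?g (?D n)) \<le> sum ?h (?Q n) - sum ?h (?D n)" for n
  proof -
    have "norm (sum ?g (?Q n - ?D n)) \<le> sum ?h (?Q n - ?D n)"
      by (rule order_trans[OF norm_sum sum_mono]) (auto simp: norm_blinfun_compose)
    then show ?thesis by (simp add: sum_diff[OF fin sub])
  qed
  ultimately have "(\<lambda>n. sum ?g (?Q n) - sum ?g (?D n)) \<longlonglongrightarrow> 0"
    by (rule Lim_null_comparison[OF always_eventually[OF allI], rotated])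
  from tendsto_diff[OF square this] show ?thesis
    by (simp add: sums_def sum.triangle_reindex)
qed

lemma compose_scaleR:
  "(r *\<^sub>R A) o\<^sub>L B = r *\<^sub>R (A o\<^sub>L B)" "A o\<^sub>L (r *\<^sub>R B) = r *\<^sub>R (A o\<^sub>L B)"
  by (rule blinfun_eqI; simp add: blinfun.bilinear_simps)+

text \<open>The operator \<open>(I + X)\<^sup>\<alpha>\<close> when \<open>\<parallel>X\<parallel> < 1\<close>.\<close>

definition op_binomial :: "real \<Rightarrow> hop \<Rightarrow> hop" where
  "op_binomial \<alpha> X = (\<Sum>n. (\<alpha> gchoose n) *\<^sub>R op_pow X n)"

lemma op_binomial_summable_norm:
  assumes "norm X < 1"
  shows "summable (\<lambda>n. norm ((\<alpha> gchoose n) *\<^sub>R op_pow X n))"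
proof (rule summable_comparison_test')
  \<comment> \<open>Inside its disk of convergence the scalar binomial series converges absolutely.\<close>
  obtain p where p: "norm X < p" "p < 1"
    using dense[OF assms] by blast
  then have abs_p: "\<bar>p\<bar> = p"
    using norm_ge_zero[of X] by linarith
  then have "summable (\<lambda>n. (\<alpha> gchoose n) * p ^ n)"
    using gen_binomial_real[of p \<alpha>] p by (simp add: sums_iff)
  then show "summable (\<lambda>n. norm ((\<alpha> gchoose n) * norm X ^ n))"
    by (rule powser_insidea) (use p abs_p in simp)
  show "norm (norm ((\<alpha> gchoose n) *\<^sub>R op_pow X n)) \<le> norm ((\<alpha> gchoose n) * norm X ^ n)" for n
  proof -
    have "\<bar>\<alpha> gchoose n\<bar> * norm (op_pow X n) \<le> \<bar>\<alpha> gchoose n\<bar> * norm X ^ n"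
      by (rule mult_left_mono[OF norm_op_pow_le abs_ge_zero])
    then show ?thesis
      by (simp only: norm_scaleR real_norm_def abs_mult abs_idempotent abs_norm_cancel power_abs)
  qed
qed

lemma op_binomial_sums:
  "norm X < 1 \<Longrightarrow> (\<lambda>n. (\<alpha> gchoose n) *\<^sub>R op_pow X n) sums op_binomial \<alpha> X"
  unfolding op_binomial_def
  by (rule summable_sums[OF summable_norm_cancel[OF op_binomial_summable_norm]])

lemma op_binomial_mult:
  assumes "norm X < 1"
  shows "op_binomial \<alpha> X o\<^sub>L op_binomial \<beta> X = op_binomial (\<alpha> + \<beta>) X"
proof -
  have "(\<Sum>i\<le>k. ((\<alpha> gchoose i) *\<^sub>R op_pow X i) o\<^sub>L ((\<beta> gchoose (k - i)) *\<^sub>R op_pow X (k - i)))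
      = ((\<alpha> + \<beta>) gchoose k) *\<^sub>R op_pow X k" for k
  proof -
    have "((\<alpha> gchoose i) *\<^sub>R op_pow X i) o\<^sub>L ((\<beta> gchoose (k - i)) *\<^sub>R op_pow X (k - i))
        = ((\<alpha> gchoose i) * (\<beta> gchoose (k - i))) *\<^sub>R op_pow X k" if "i \<in> {0..k}" for i
    proof -
      have "op_pow X k = op_pow X i o\<^sub>L op_pow X (k - i)"
        using op_pow_add[of X i "k - i"] that by simp
      then show ?thesis
        unfolding compose_scaleR by (simp add: mult.commute)
    qed
    then have "(\<Sum>i\<le>k. ((\<alpha> gchoose i) *\<^sub>R op_pow X i) o\<^sub>L ((\<beta> gchoose (k - i)) *\<^sub>R op_pow X (k - i)))
        = (\<Sum>i=0..k. ((\<alpha> gchoose i) * (\<beta> gchoose (k - i))) *\<^sub>R op_pow X k)"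
      unfolding atMost_atLeast0 by (rule sum.cong[OF refl])
    also have "\<dots> = (\<Sum>i=0..k. (\<alpha> gchoose i) * (\<beta> gchoose (k - i))) *\<^sub>R op_pow X k"
      by (rule scaleR_sum_left[symmetric])
    finally show ?thesis
      by (simp only: gbinomial_Vandermonde)
  qed
  then have "(\<lambda>k. ((\<alpha> + \<beta>) gchoose k) *\<^sub>R op_pow X k) sums (op_binomial \<alpha> X o\<^sub>L op_binomial \<beta> X)"
    using Cauchy_product_blinfun_compose[OF op_binomial_summable_norm[OF assms, of \<alpha>]
        op_binomial_summable_norm[OF assms, of \<beta>]]
    unfolding op_binomial_def by (simp only:)
  then show ?thesis
    using op_binomial_sums[OF assms, of "\<alpha> + \<beta>"] by (rule sums_unique2)
qed

lemma op_binomial_0 [simp]: "op_binomial 0 X = id_blinfun"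
proof -
  have "(0::real) gchoose n = 0" if "n \<notin> {0}" for n
    using that by (cases n) (simp_all add: gbinomial_0(2))
  then have "op_binomial 0 X = (\<Sum>n\<in>{0}. ((0::real) gchoose n) *\<^sub>R op_pow X n)"
    unfolding op_binomial_def by (intro suminf_finite) simp_all
  then show ?thesis by simp
qed

lemma op_binomial_1 [simp]: "op_binomial 1 X = id_blinfun + X"
proof -
  have "(1::real) gchoose n = 0" if "n \<notin> {0, 1}" for n
  proof -
    have "1 < n" using that by auto
    then have "real (1 choose n) = 0" by (simp add: binomial_eq_0)
    then show ?thesis by (simp only: binomial_gbinomial of_nat_1)
  qed
  then have "op_binomial 1 X = (\<Sum>n\<in>{0, 1}. ((1::real) gchoose n) *\<^sub>R op_pow X n)"
    unfolding op_binomial_def by (intro suminf_finite) simp_all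
  then show ?thesis by simp
qed

lemma op_binomial_commute:
  assumes "norm X < 1" "X o\<^sub>L Q = Q o\<^sub>L X"
  shows "op_binomial \<alpha> X o\<^sub>L Q = Q o\<^sub>L op_binomial \<alpha> X"
proof -
  have "((\<alpha> gchoose n) *\<^sub>R op_pow X n) o\<^sub>L Q = Q o\<^sub>L ((\<alpha> gchoose n) *\<^sub>R op_pow X n)" for n
    using op_pow_commute[OF assms(2), of n]
    by (simp only: compose_scaleR)
  then have "(\<lambda>n. Q o\<^sub>L ((\<alpha> gchoose n) *\<^sub>R op_pow X n)) sums (op_binomial \<alpha> X o\<^sub>L Q)"
    using bounded_linear.sums[OF bounded_linear_compose_left op_binomial_sums[OF assms(1)], of \<alpha> Q]
    by (simp only:)
  then show ?thesis
    by (rule sums_unique2[OF _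
        bounded_linear.sums[OF bounded_linear_compose_right op_binomial_sums[OF assms(1)], of Q \<alpha>]])
qed

lemma op_binomial_clinear:
  assumes "norm X < 1" "clinear_op X"
  shows "clinear_op (op_binomial \<alpha> X)"
  unfolding clinear_op_def
proof (intro allI)
  fix c f
  have ev: "(\<lambda>n. blinfun_apply ((\<alpha> gchoose n) *\<^sub>R op_pow X n) g) sums op_binomial \<alpha> X g" for g
    by (intro bounded_linear.sums[OF blinfun.bounded_linear_left] op_binomial_sums assms)
  have "((\<alpha> gchoose n) *\<^sub>R op_pow X n) (c *\<^sub>C f) = c *\<^sub>C (((\<alpha> gchoose n) *\<^sub>R op_pow X n) f)" for n
    using clinear_scaleR[OF clinear_pow[OF assms(2)]] by (auto simp only: clinear_op_def)
  then have "(\<lambda>n. c *\<^sub>C ((\<alpha> gchoose n) *\<^sub>R op_pow X n) f) sums op_binomial \<alpha> X (c *\<^sub>C f)"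
    using ev[of "c *\<^sub>C f"] by (simp only:)
  then show "op_binomial \<alpha> X (c *\<^sub>C f) = c *\<^sub>C op_binomial \<alpha> X f"
    by (rule sums_unique2[OF _ bounded_linear.sums[OF bounded_linear_cscale ev[of f], of c]])
qed

lemma op_binomial_adjoint:
  assumes "norm X < 1" "is_adjoint X X"
  shows "is_adjoint (op_binomial \<alpha> X) (op_binomial \<alpha> X)"
  unfolding is_adjoint_def
proof (intro allI)
  fix f g
  have ev: "(\<lambda>n. blinfun_apply ((\<alpha> gchoose n) *\<^sub>R op_pow X n) h) sums op_binomial \<alpha> X h" for h
    by (intro bounded_linear.sums[OF blinfun.bounded_linear_left] op_binomial_sums assms)
  have "cinner (((\<alpha> gchoose n) *\<^sub>R op_pow X n) f) g = cinner f (((\<alpha> gchoose n) *\<^sub>R op_pow X n) g)" for n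
    by (intro is_adjointD is_adjoint_scaleR is_adjoint_pow assms)
  then have "(\<lambda>n. cinner f (((\<alpha> gchoose n) *\<^sub>R op_pow X n) g)) sums cinner (op_binomial \<alpha> X f) g"
    using bounded_linear.sums[OF bounded_linear_cinner_left ev[of f], of g] by (simp only:)
  then show "cinner (op_binomial \<alpha> X f) g = cinner f (op_binomial \<alpha> X g)"
    by (rule sums_unique2[OF _ bounded_linear.sums[OF bounded_linear_cinner_right ev[of g], of f]])
qed


lemma op_pow_conj:
  assumes "W o\<^sub>L W = id_blinfun"
  shows "op_pow (W o\<^sub>L X o\<^sub>L W) n = W o\<^sub>L op_pow X n o\<^sub>L W"
proof (induction n)
  case (Suc n)
  have "op_pow (W o\<^sub>L X o\<^sub>L W) (Suc n) = W o\<^sub>L X o\<^sub>L (W o\<^sub>L W) o\<^sub>L op_pow X n o\<^sub>L W"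
    unfolding op_pow.simps(2) Suc by (simp only: compose_assoc)
  then show ?case
    by (simp add: assms compose_assoc)
qed (simp add: assms)

lemma op_binomial_conj:
  assumes W: "W o\<^sub>L W = id_blinfun" and X: "norm X < 1" and WX: "norm (W o\<^sub>L X o\<^sub>L W) < 1"
  shows "op_binomial \<alpha> (W o\<^sub>L X o\<^sub>L W) = W o\<^sub>L op_binomial \<alpha> X o\<^sub>L W"
proof (rule sums_unique2)
  show "(\<lambda>n. (\<alpha> gchoose n) *\<^sub>R op_pow (W o\<^sub>L X o\<^sub>L W) n) sums op_binomial \<alpha> (W o\<^sub>L X o\<^sub>L W)"
    by (rule op_binomial_sums[OF WX])
  have "(\<lambda>n. W o\<^sub>L ((\<alpha> gchoose n) *\<^sub>R op_pow X n) o\<^sub>L W) sums (W o\<^sub>L op_binomial \<alpha> X o\<^sub>L W)"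
    by (rule bounded_linear.sums[OF bounded_linear_compose_left
          bounded_linear.sums[OF bounded_linear_compose_right op_binomial_sums[OF X]]])
  then show "(\<lambda>n. (\<alpha> gchoose n) *\<^sub>R op_pow (W o\<^sub>L X o\<^sub>L W) n) sums (W o\<^sub>L op_binomial \<alpha> X o\<^sub>L W)"
    by (simp only: op_pow_conj[OF W] compose_scaleR)
qed

lemma op_binomial_cancel:
  assumes "norm X < 1"
  shows "op_binomial \<alpha> X (op_binomial (- \<alpha>) X f) = f"
proof -
  have "(op_binomial \<alpha> X o\<^sub>L op_binomial (- \<alpha>) X) f = f"
    by (simp only: op_binomial_mult[OF assms]) simp
  then show ?thesis by simp
qed

section \<open>Square roots and polar decomposition\<close>

text \<open>The fourth root \<open>R = (I + X)\<^sup>1\<^sup>/\<^sup>4\<close> is selfadjoint and injective, so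
  \<open>\<langle>R\<^sup>2 f, f\<rangle> = \<parallel>R f\<parallel>\<^sup>2\<close> shows that the square root series is strictly positive without a look at the
  signs of its coefficients. Strict positivity of this one root makes it the only positive one.\<close>

lemma op_sqrt_affine:
  assumes lin: "clinear_op X" and sa: "is_adjoint X X" and X: "norm X < 1" and \<kappa>: "0 < \<kappa>"
  shows "op_sqrt (\<kappa> *\<^sub>R (id_blinfun + X)) = sqrt \<kappa> *\<^sub>R op_binomial (1/2) X"
proof -
  define P where "P = sqrt \<kappa> *\<^sub>R op_binomial (1/2) X"
  have PP: "P o\<^sub>L P = \<kappa> *\<^sub>R (id_blinfun + X)"
    using \<kappa> by (simp add: P_def compose_scaleR op_binomial_mult[OF X])
  have quad: "cinner (P f) f = of_real (sqrt \<kappa> * (norm (op_binomial (1/4) X f))\<^sup>2)" for f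
  proof -
    have "P f = sqrt \<kappa> *\<^sub>R op_binomial (1/4) X (op_binomial (1/4) X f)"
      using op_binomial_mult[OF X, of "1/4" "1/4"]
      by (simp add: P_def blinfun.bilinear_simps flip: blinfun_apply_blinfun_compose)
    then show ?thesis
      by (simp add: is_adjointD[OF op_binomial_adjoint[OF X sa]] cinner_self scaleR_conv_of_real)
  qed
  have pos: "positive_op P"
    unfolding positive_op_def quad
    using \<kappa> by (auto simp: P_def intro!: clinear_scaleR op_binomial_clinear X lin)
  have zero: "f = 0" if "Re (cinner (P f) f) \<le> 0" for f
  proof -
    have "(norm (op_binomial (1/4) X f))\<^sup>2 \<le> 0"
      using that \<kappa> by (simp add: quad mult_le_0_iff)
    then have "op_binomial (1/4) X f = 0" by simp
    then show ?thesis
      using op_binomial_cancel[OF X, of "-1/4" f] by (simp add: blinfun.zero_right)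
  qed
  show ?thesis
    unfolding op_sqrt_def P_def[symmetric]
  proof (rule the_equality)
    show "positive_op P \<and> P o\<^sub>L P = \<kappa> *\<^sub>R (id_blinfun + X)"
      using pos PP by simp
    fix Q assume Q: "positive_op Q \<and> Q o\<^sub>L Q = \<kappa> *\<^sub>R (id_blinfun + X)"
    have X_eq: "X = (1/\<kappa>) *\<^sub>R (Q o\<^sub>L Q) - id_blinfun"
      using Q \<kappa> by simp
    have "X o\<^sub>L Q = Q o\<^sub>L X"
      unfolding X_eq by (rule blinfun_eqI) (simp add: blinfun.bilinear_simps)
    from op_binomial_commute[OF X this] have PQ: "P o\<^sub>L Q = Q o\<^sub>L P"
      by (simp add: P_def compose_scaleR)
    show "Q = P"
    proof (rule blinfun_eqI)
      fix f
      \<comment> \<open>\<open>(P + Q) (P - Q) = P\<^sup>2 - Q\<^sup>2 = 0\<close> since \<open>P\<close> and \<open>Q\<close> commute.\<close>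
      define g where "g = P f - Q f"
      have "P (P f) = Q (Q f)" "P (Q f) = Q (P f)"
        using PP Q PQ by (metis blinfun_apply_blinfun_compose)+
      then have "P g + Q g = 0"
        by (simp add: g_def blinfun.bilinear_simps)
      then have "cinner (P g) g + cinner (Q g) g = 0"
        by (simp flip: cinner_add_left)
      then have "Re (cinner (P g) g) + Re (cinner (Q g) g) = 0"
        by (simp flip: plus_complex.sel)
      moreover have "0 \<le> Re (cinner (Q g) g)"
        using Q by (simp add: positive_op_def)
      ultimately have "g = 0" by (intro zero) linarith
      then show "Q f = P f" by (simp add: g_def)
    qed
  qed
qed

lemma op_abs_affine:
  assumes lin: "clinear_op X" and sa: "is_adjoint X X" and X: "norm X < 1" and \<kappa>: "0 < \<kappa>"
    and A: "adj A o\<^sub>L A = \<kappa> *\<^sub>R (id_blinfun + X)"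
  shows op_abs_affine_eq: "op_abs A = sqrt \<kappa> *\<^sub>R op_binomial (1/2) X"
    and invertible_op_abs_affine: "invertible_op (op_abs A)"
    and op_inv_op_abs_affine: "op_inv (op_abs A) = (1 / sqrt \<kappa>) *\<^sub>R op_binomial (-1/2) X"
    and op_abs_affine_cancel: "op_abs A o\<^sub>L op_inv (op_abs A) = id_blinfun"
      "op_inv (op_abs A) o\<^sub>L op_abs A = id_blinfun"
    and is_adjoint_op_abs_affine: "is_adjoint (op_abs A) (op_abs A)"
    and op_abs_affine_square: "op_abs A o\<^sub>L op_abs A = adj A o\<^sub>L A"
proof -
  show abs: "op_abs A = sqrt \<kappa> *\<^sub>R op_binomial (1/2) X"
    unfolding op_abs_def A by (rule op_sqrt_affine[OF lin sa X \<kappa>])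
  show "is_adjoint (op_abs A) (op_abs A)"
    unfolding abs by (intro is_adjoint_scaleR op_binomial_adjoint X sa)
  show "op_abs A o\<^sub>L op_abs A = adj A o\<^sub>L A"
    unfolding abs A using \<kappa> by (simp add: compose_scaleR op_binomial_mult[OF X])
  let ?B = "(1 / sqrt \<kappa>) *\<^sub>R op_binomial (-1/2) X"
  have inv: "op_abs A o\<^sub>L ?B = id_blinfun" "?B o\<^sub>L op_abs A = id_blinfun"
    using \<kappa> by (simp_all add: abs compose_scaleR op_binomial_mult[OF X])
  show eq: "op_inv (op_abs A) = ?B"
    by (rule op_inv_eqI[OF inv])
  show "op_abs A o\<^sub>L op_inv (op_abs A) = id_blinfun" "op_inv (op_abs A) o\<^sub>L op_abs A = id_blinfun"
    unfolding eq by (fact inv)+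
  show "invertible_op (op_abs A)"
    unfolding invertible_op_def using inv by blast
qed

lemma norm_op_abs:
  assumes "is_adjoint (op_abs A) (op_abs A)" "op_abs A o\<^sub>L op_abs A = adj A o\<^sub>L A" "is_adjoint A (adj A)"
  shows "norm (op_abs A f) = norm (A f)"
proof -
  have "cinner (op_abs A f) (op_abs A f) = cinner f ((op_abs A o\<^sub>L op_abs A) f)"
    by (simp add: is_adjointD[OF assms(1)])
  also have "\<dots> = cinner (A f) (A f)"
    by (simp add: assms(2) is_adjointD[OF assms(3)])
  finally have "(norm (op_abs A f))\<^sup>2 = (norm (A f))\<^sup>2"
    unfolding cinner_self of_real_eq_iff .
  then show ?thesis by simp
qed

text \<open>When \<open>\<bar>A\<bar>\<close> is invertible, \<open>A = U \<bar>A\<bar>\<close> can be solved for \<open>U\<close>, which settles uniqueness.\<close>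

lemma polar_part_invertible:
  assumes B: "op_abs A o\<^sub>L B = id_blinfun" "B o\<^sub>L op_abs A = id_blinfun"
    and lin: "clinear_op (A o\<^sub>L B)" and iso: "\<And>f. norm (A (B f)) = norm f"
  shows "polar_part A = A o\<^sub>L B"
  unfolding polar_part_def
proof (rule the_equality)
  have A_eq: "A = A o\<^sub>L B o\<^sub>L op_abs A"
    by (simp add: compose_assoc B)
  have "(A o\<^sub>L B) f = 0 \<longleftrightarrow> A f = 0" for f
  proof -
    have inj: "A (B g) = 0 \<longleftrightarrow> g = 0" for g
      using iso[of g] by (metis norm_eq_zero)
    have "A f = 0 \<longleftrightarrow> op_abs A f = 0"
      using arg_cong[OF A_eq, of "\<lambda>C. blinfun_apply C f"] inj[of "op_abs A f"] by simp
    also have "\<dots> \<longleftrightarrow> f = 0"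
      using arg_cong[OF B(2), of "\<lambda>C. blinfun_apply C f"] by (auto simp: blinfun.zero_right)
    finally show ?thesis using inj by simp
  qed
  then show "partial_isometry (A o\<^sub>L B) \<and> (\<forall>f. (A o\<^sub>L B) f = 0 \<longleftrightarrow> A f = 0) \<and>
      A = (A o\<^sub>L B) o\<^sub>L op_abs A"
    using A_eq lin iso by (simp add: partial_isometry_def)
  fix U assume "partial_isometry U \<and> (\<forall>f. U f = 0 \<longleftrightarrow> A f = 0) \<and> A = U o\<^sub>L op_abs A"
  then have "A o\<^sub>L B = U o\<^sub>L (op_abs A o\<^sub>L B)"
    by (metis compose_assoc)
  then show "U = A o\<^sub>L B" by (simp add: B)
qed


section \<open>The shift and its adjoint\<close>

lemma sums_Suc_0: "f sums s" if "(\<lambda>n. f (Suc n)) sums s" "f 0 = 0"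
  for f :: "nat \<Rightarrow> 'a::real_normed_vector"
  using sums_Suc[OF that(1)] that(2) by simp

text \<open>The shift and its adjoint act on Taylor coefficients by translating the index, and most of
  their properties are immediate in this form.\<close>

definition shift_fun :: "hardy \<Rightarrow> hardy" where
  "shift_fun f = of_coeffs (case_nat 0 (hcoeff f))"

lemma hcoeff_shift_fun: "hcoeff (shift_fun f) n = case_nat 0 (hcoeff f) n"
  unfolding shift_fun_def
proof (rule hcoeff_of_coeffs)
  show "summable (\<lambda>n. (norm (case n of 0 \<Rightarrow> 0 | Suc k \<Rightarrow> hcoeff f k))\<^sup>2)"
    by (subst summable_Suc_iff[symmetric]) (simp add: summable_hcoeff)
qed

lemma hfun_shift_fun: "hfun (shift_fun f) z = z * hfun f z" if "norm z < 1"
proof (rule sums_unique2[OF hfun_sums[OF that]])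
  show "(\<lambda>n. hcoeff (shift_fun f) n * z ^ n) sums (z * hfun f z)"
    using sums_mult[OF hfun_sums[OF that, of f], of z]
    by - (rule sums_Suc_0, simp_all add: hcoeff_shift_fun mult_ac)
qed

lemma norm_shift_fun: "norm (shift_fun f) = norm f"
proof -
  have "(\<lambda>n. (norm (hcoeff (shift_fun f) n))\<^sup>2) sums (norm f)\<^sup>2"
    by (rule sums_Suc_0) (simp_all add: hcoeff_shift_fun norm_sq_sums)
  then have "(norm (shift_fun f))\<^sup>2 = (norm f)\<^sup>2"
    using norm_sq_sums sums_unique2 by blast
  then show ?thesis by simp
qed

lemma shift_eq: "blinfun_apply shift = shift_fun"
proof -
  have "(\<lambda>f. hardy_of (\<lambda>z. z * hfun f z)) = shift_fun"
    by (rule ext) (rule hardy_of_eqI, rule hfun_shift_fun)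
  moreover have "bounded_linear shift_fun"
  proof (rule bounded_linear_intro[where K = 1])
    show "shift_fun (f + g) = shift_fun f + shift_fun g" for f g
      by (rule hardy_eqI) (simp add: hcoeff_shift_fun split: nat.split)
    show "shift_fun (r *\<^sub>R f) = r *\<^sub>R shift_fun f" for r f
      by (rule hardy_eqI) (simp add: hcoeff_shift_fun split: nat.split)
  qed (simp add: norm_shift_fun)
  ultimately show ?thesis
    unfolding shift_def by (simp only: bounded_linear_Blinfun_apply)
qed

lemma hcoeff_shift: "hcoeff (shift f) n = case_nat 0 (hcoeff f) n"
  and hfun_shift: "norm z < 1 \<Longrightarrow> hfun (shift f) z = z * hfun f z"
  and norm_shift: "norm (shift f) = norm f"
  by (simp_all add: shift_eq hcoeff_shift_fun hfun_shift_fun norm_shift_fun)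

lemma clinear_shift: "clinear_op shift"
  unfolding clinear_op_def by (auto intro!: hardy_eqI simp: hcoeff_shift split: nat.split)

definition backward_shift_fun :: "hardy \<Rightarrow> hardy" where
  "backward_shift_fun f = of_coeffs (\<lambda>n. hcoeff f (Suc n))"

lemma hcoeff_backward_shift_fun: "hcoeff (backward_shift_fun f) n = hcoeff f (Suc n)"
  unfolding backward_shift_fun_def
proof (rule hcoeff_of_coeffs)
  show "summable (\<lambda>n. (norm (hcoeff f (Suc n)))\<^sup>2)"
    using summable_hcoeff[of f] summable_Suc_iff[of "\<lambda>n. (norm (hcoeff f n))\<^sup>2"] by simp
qed

lemma norm_backward_shift_fun_le: "norm (backward_shift_fun f) \<le> norm f"
proof (rule norm_le_coeffs)
  fix N
  have "(\<Sum>n<N. (norm (hcoeff (backward_shift_fun f) n))\<^sup>2) = (\<Sum>n\<in>Suc ` {..<N}. (norm (hcoeff f n))\<^sup>2)"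
    by (simp add: hcoeff_backward_shift_fun sum.reindex)
  also have "\<dots> \<le> (norm f)\<^sup>2" by (rule sum_hcoeff_le) simp
  finally show "(\<Sum>n<N. (norm (hcoeff (backward_shift_fun f) n))\<^sup>2) \<le> (norm f)\<^sup>2" .
qed simp

lift_definition backward_shift :: hop is backward_shift_fun
  by (rule bounded_linear_intro[where K = 1])
    (auto intro!: hardy_eqI simp: hcoeff_backward_shift_fun norm_backward_shift_fun_le)

lemma hcoeff_backward_shift: "hcoeff (backward_shift f) n = hcoeff f (Suc n)"
  and norm_backward_shift_le: "norm (backward_shift f) \<le> norm f"
  by (simp_all add: backward_shift.rep_eq hcoeff_backward_shift_fun norm_backward_shift_fun_le)

lemma is_adjoint_shift: "is_adjoint shift backward_shift"
  unfolding is_adjoint_def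
proof (intro allI)
  fix f g
  have "(\<lambda>n. hcoeff (shift f) n * cnj (hcoeff g n)) sums cinner f (backward_shift g)"
    using cinner_sums[of f "backward_shift g"]
    by - (rule sums_Suc_0, simp_all add: hcoeff_shift hcoeff_backward_shift)
  then show "cinner (shift f) g = cinner f (backward_shift g)"
    using cinner_sums sums_unique2 by blast
qed

lemma backward_shift_shift [simp]: "backward_shift (shift f) = f"
  by (rule hardy_eqI) (simp add: hcoeff_shift hcoeff_backward_shift)

lemma clinear_backward_shift: "clinear_op backward_shift"
  unfolding clinear_op_def by (auto intro!: hardy_eqI simp: hcoeff_backward_shift)

lemma norm_op_scale_le: "norm (op_scale c A) \<le> norm c * norm A"
proof (rule norm_blinfun_bound)
  show "norm (op_scale c A f) \<le> norm c * norm A * norm f" for f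
    using mult_left_mono[OF norm_blinfun[of A f], of "norm c"] by (simp add: norm_cscale mult.assoc)
qed simp

lemma norm_shift_le: "norm shift \<le> 1" and norm_backward_shift_op_le: "norm backward_shift \<le> 1"
  by (rule norm_blinfun_bound; simp add: norm_shift norm_backward_shift_le)+


section \<open>The weighted composition operator\<close>

lemma one_minus_ne: "1 - cnj a * z \<noteq> 0" if "norm a < 1" "norm z < 1"
proof
  assume "1 - cnj a * z = 0"
  then have "norm (cnj a * z) = 1" by (metis eq_iff_diff_eq_0 norm_one)
  then show False
    using mult_strict_mono'[of "norm a" 1 "norm z" 1] that by (simp add: norm_mult)
qed

lemma disk_aut_norm: "norm (disk_aut a z) < 1" if "norm a < 1" "norm z < 1"
proof -
  have "disk_aut a z = - Moebius_function 0 a z"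
    by (simp add: disk_aut_def Moebius_function_def minus_divide_left)
  then show ?thesis using Moebius_function_norm_lt_1[OF that, of 0] by simp
qed

lemma cnj_mult_self: "cnj a * a = of_real ((norm a)\<^sup>2)" "a * cnj a = of_real ((norm a)\<^sup>2)"
  by (simp_all only: complex_norm_square mult.commute)

lemma one_minus_norm_ne: "complex_of_real (1 - (norm a)\<^sup>2) \<noteq> 0" if "norm (a :: complex) < 1"
  using that by (simp add: abs_square_eq_1 del: of_real_diff of_real_power)

lemma of_real_sqrt_square:
  "complex_of_real (sqrt (1 - (norm a)\<^sup>2)) * of_real (sqrt (1 - (norm a)\<^sup>2)) = of_real (1 - (norm a)\<^sup>2)"
  if "norm (a :: complex) < 1"
  using that by (simp add: abs_square_le_1 flip: of_real_mult)

lemma one_minus_disk_aut: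
  "1 - cnj a * disk_aut a z = of_real (1 - (norm a)\<^sup>2) / (1 - cnj a * z)"
  if "norm a < 1" "norm z < 1"
  using one_minus_ne[OF that]
  by (simp add: disk_aut_def field_simps cnj_mult_self del: of_real_power)

lemma disk_aut_involution: "disk_aut a (disk_aut a z) = z" if "norm a < 1" "norm z < 1"
proof -
  have "a - disk_aut a z = z * of_real (1 - (norm a)\<^sup>2) / (1 - cnj a * z)"
    using one_minus_ne[OF that]
    by (simp add: disk_aut_def field_simps cnj_mult_self del: of_real_power)
  then show ?thesis
    unfolding disk_aut_def[of a "disk_aut a z"] one_minus_disk_aut[OF that]
    using one_minus_ne[OF that] one_minus_norm_ne[OF that(1)] by (simp del: of_real_power of_real_diff)
qed

text \<open>Multiplication by the disk automorphism \<open>(a - z) / (1 - cnj a z)\<close>: the second factor is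
  \<open>(I - cnj a S)\<^sup>-\<^sup>1\<close>.\<close>

definition blaschke_op :: "complex \<Rightarrow> hop" where
  "blaschke_op a = (op_scale a id_blinfun - shift)
     o\<^sub>L op_binomial (-1) (- op_scale (cnj a) shift)"

lemma norm_scaled_shift_lt: "norm (- op_scale (cnj a) shift) < 1" if "norm a < 1"
  using norm_op_scale_le[of "cnj a" shift] mult_left_mono[OF norm_shift_le, of "norm a"] that by simp

text \<open>This identity is the reason that multiplication by \<open>disk_aut a\<close> is isometric. As \<open>S\<close> is an
  isometry, both squares expand to \<open>(1 + \<bar>a\<bar>\<^sup>2) \<parallel>f\<parallel>\<^sup>2 - 2 Re \<langle>f, cnj a S f\<rangle>\<close>.\<close>

lemma norm_scale_diff_shift: "norm (a *\<^sub>C f - shift f) = norm (f - cnj a *\<^sub>C shift f)"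
proof -
  have "inner (a *\<^sub>C f) (shift f) = inner f (cnj a *\<^sub>C shift f)"
    by (simp flip: Re_cinner)
  then have "(norm (a *\<^sub>C f - shift f))\<^sup>2 = (norm (f - cnj a *\<^sub>C shift f))\<^sup>2"
    using dot_norm_neg[of "a *\<^sub>C f" "shift f"] dot_norm_neg[of f "cnj a *\<^sub>C shift f"]
    by (simp add: norm_cscale norm_shift)
  then show ?thesis by simp
qed

lemma blaschke_op:
  assumes a: "norm a < 1"
  shows hfun_blaschke_op: "norm z < 1 \<Longrightarrow> hfun (blaschke_op a f) z = disk_aut a z * hfun f z"
    and norm_blaschke_op: "norm (blaschke_op a f) = norm f"
    and clinear_blaschke_op: "clinear_op (blaschke_op a)"
proof -
  let ?G = "op_binomial (-1) (- op_scale (cnj a) shift)"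
  have G: "?G f - cnj a *\<^sub>C shift (?G f) = f"
    using op_binomial_cancel[OF norm_scaled_shift_lt[OF a], of 1 f] by (simp add: blinfun.bilinear_simps)
  have ap: "blaschke_op a f = a *\<^sub>C ?G f - shift (?G f)"
    by (simp add: blaschke_op_def blinfun.bilinear_simps)
  show "norm (blaschke_op a f) = norm f"
    by (simp only: ap norm_scale_diff_shift G)
  show "clinear_op (blaschke_op a)"
    unfolding blaschke_op_def
    by (intro clinear_compose clinear_diff clinear_op_scale clinear_id clinear_shift
        op_binomial_clinear norm_scaled_shift_lt a)
      (use clinear_scaleR[OF clinear_op_scale[OF clinear_shift], of "-1" "cnj a"] in simp)
  assume z: "norm z < 1"
  have "hfun (?G f) z * (1 - cnj a * z) = hfun f z"
    using arg_cong[OF G, of "\<lambda>g. hfun g z"] by (simp add: hfun_shift[OF z] algebra_simps)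
  then have "disk_aut a z * hfun f z = (a - z) * hfun (?G f) z"
    using one_minus_ne[OF a z] by (simp add: disk_aut_def flip: \<open>_ = hfun f z\<close>)
  then show "hfun (blaschke_op a f) z = disk_aut a z * hfun f z"
    by (simp add: ap hfun_shift[OF z] left_diff_distrib)
qed

text \<open>The Takenaka--Malmquist functions for a single repeated point \<open>a\<close>; they are the images
  of the monomials \<open>z\<^sup>n\<close> under \<open>W_op a\<close>.\<close>

definition takenaka :: "complex \<Rightarrow> nat \<Rightarrow> hardy" where
  "takenaka a n = op_pow (blaschke_op a) n (of_real (sqrt (1 - (norm a)\<^sup>2)) *\<^sub>C kernel a)"

lemma hfun_takenaka:
  assumes a: "norm a < 1" and z: "norm z < 1"
  shows "hfun (takenaka a n) z
    = of_real (sqrt (1 - (norm a)\<^sup>2)) / (1 - cnj a * z) * disk_aut a z ^ n"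
  unfolding takenaka_def
  by (induction n) (simp_all add: hfun_blaschke_op[OF a z] hfun_kernel[OF a z])

text \<open>Cancelling the isometry \<open>M\<^sup>n\<close> leaves an inner product with the reproducing kernel at \<open>a\<close>, that
  is, a value at \<open>a\<close>; and \<open>disk_aut a a = 0\<close>.\<close>

lemma takenaka_orthonormal:
  assumes a: "norm a < 1"
  shows "cinner (takenaka a m) (takenaka a n) = (if m = n then 1 else 0)"
proof -
  have pow_iso: "cinner (op_pow (blaschke_op a) n f) (op_pow (blaschke_op a) n g) = cinner f g" for n f g
    by (induction n)
      (simp_all add: isometry_cinner[OF clinear_blaschke_op[OF a] norm_blaschke_op[OF a]])
  have diff: "cinner (takenaka a (n + k)) (takenaka a n) = (if k = 0 then 1 else 0)" for n k
  proof -
    have "cinner (takenaka a (n + k)) (takenaka a n) = cinner (takenaka a k) (takenaka a 0)"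
      by (simp add: takenaka_def op_pow_add pow_iso)
    also have "\<dots> = of_real (sqrt (1 - (norm a)\<^sup>2)) * hfun (takenaka a k) a"
      by (simp add: takenaka_def[of a 0] cinner_kernel[OF a])
    also have "\<dots> = of_real (1 - (norm a)\<^sup>2) / of_real (1 - (norm a)\<^sup>2) * 0 ^ k"
    proof -
      have "1 - cnj a * a = of_real (1 - (norm a)\<^sup>2)" by (simp add: cnj_mult_self)
      then show ?thesis
        unfolding hfun_takenaka[OF a a] of_real_sqrt_square[OF a, symmetric]
        by (simp add: disk_aut_def)
    qed
    also have "\<dots> = (if k = 0 then 1 else 0)"
      unfolding divide_self[OF one_minus_norm_ne[OF a]] by simp
    finally show ?thesis .
  qed
  show ?thesis
  proof (cases "n \<le> m")
    case True
    then show ?thesis using diff[of n "m - n"] by auto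
  next
    case False
    then show ?thesis
      using diff[of m "n - m"] cinner_commute[of "takenaka a m" "takenaka a n"] by auto
  qed
qed

lemma orthonormal_sum_norm:
  assumes e: "\<And>m n. cinner (e m) (e n) = (if m = n then 1 else 0)" and "finite A"
  shows "(norm (\<Sum>n\<in>A. x n *\<^sub>C e n))\<^sup>2 = (\<Sum>n\<in>A. (norm (x n))\<^sup>2)"
  using \<open>finite A\<close>
proof (induction A)
  case (insert k A)
  have "cinner (\<Sum>n\<in>A. x n *\<^sub>C e n) (x k *\<^sub>C e k) = (\<Sum>n\<in>A. cinner (x n *\<^sub>C e n) (x k *\<^sub>C e k))"
    by (rule linear_sum[OF bounded_linear.linear[OF bounded_linear_cinner_left]])
  also have "\<dots> = 0"
    using insert.hyps by (intro sum.neutral) (auto simp: e)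
  finally have "inner (\<Sum>n\<in>A. x n *\<^sub>C e n) (x k *\<^sub>C e k) = 0"
    unfolding Re_cinner[symmetric] by (simp only: zero_complex.sel)
  then have "(norm (x k *\<^sub>C e k + (\<Sum>n\<in>A. x n *\<^sub>C e n)))\<^sup>2
      = (norm (x k *\<^sub>C e k))\<^sup>2 + (norm (\<Sum>n\<in>A. x n *\<^sub>C e n))\<^sup>2"
    by (simp add: power2_norm_eq_inner inner_add_left inner_add_right inner_commute)
  moreover have "(norm (e k))\<^sup>2 = 1"
    using e[of k k] cinner_self[of "e k"] by (metis of_real_eq_1_iff)
  ultimately show ?case
    using insert by (simp add: norm_cscale power_mult_distrib)
qed simp

lemma orthonormal_series:
  fixes x :: "nat \<Rightarrow> complex"
  assumes e: "\<And>m n. cinner (e m) (e n) = (if m = n then 1 else 0)"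
    and x: "(\<lambda>n. (norm (x n))\<^sup>2) sums c\<^sup>2" and c: "0 \<le> c"
  obtains h where "(\<lambda>n. x n *\<^sub>C e n) sums h" "norm h = c"
proof -
  have "summable (\<lambda>n. x n *\<^sub>C e n)"
    unfolding summable_Cauchy
  proof (intro allI impI)
    fix d :: real assume d: "0 < d"
    then obtain N where N: "\<And>m n. m \<ge> N \<Longrightarrow> norm (\<Sum>k=m..<n. (norm (x k))\<^sup>2) < d\<^sup>2"
      using sums_summable[OF x] unfolding summable_Cauchy by (meson zero_less_power)
    have "norm (\<Sum>k=m..<n. x k *\<^sub>C e k) < d" if "m \<ge> N" for m n
      by (rule power_less_imp_less_base[of _ 2])
        (use N[OF that, of n] d in \<open>simp_all add: orthonormal_sum_norm[OF e]\<close>)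
    then show "\<exists>N. \<forall>m\<ge>N. \<forall>n. norm (\<Sum>k=m..<n. x k *\<^sub>C e k) < d" by blast
  qed
  then obtain h where h: "(\<lambda>n. x n *\<^sub>C e n) sums h" by (auto simp: summable_def)
  have "(\<lambda>N. (norm (\<Sum>n<N. x n *\<^sub>C e n))\<^sup>2) \<longlonglongrightarrow> (norm h)\<^sup>2"
    using h unfolding sums_def by (intro tendsto_intros)
  then have "(\<lambda>n. (norm (x n))\<^sup>2) sums (norm h)\<^sup>2"
    by (simp add: sums_def orthonormal_sum_norm[OF e])
  then have "(norm h)\<^sup>2 = c\<^sup>2" using x by (rule sums_unique2)
  then have "norm h = c" using c by simp
  with h show ?thesis by (rule that)
qed

text \<open>Expand \<open>f = \<Sum>n. f\<^sub>n z\<^sup>n\<close> and sum \<open>\<Sum>n. f\<^sub>n e\<^sub>n\<close> over the orthonormal functions \<open>e\<^sub>n = takenaka a n\<close>.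
  Evaluation at a point is continuous, so the sum is the expected function.\<close>

lemma weighted_composition_exists:
  assumes a: "norm a < 1"
  shows "\<exists>h. norm h = norm f \<and> (\<forall>z. norm z < 1 \<longrightarrow>
    hfun h z = of_real (sqrt (1 - (norm a)\<^sup>2)) / (1 - cnj a * z) * hfun f (disk_aut a z))"
proof -
  obtain h where h: "(\<lambda>n. hcoeff f n *\<^sub>C takenaka a n) sums h" "norm h = norm f"
    by (rule orthonormal_series[OF takenaka_orthonormal[OF a] norm_sq_sums norm_ge_zero])
  have "hfun h z = of_real (sqrt (1 - (norm a)\<^sup>2)) / (1 - cnj a * z) * hfun f (disk_aut a z)"
    if z: "norm z < 1" for z
  proof (rule sums_unique2)
    show "(\<lambda>n. hfun (hcoeff f n *\<^sub>C takenaka a n) z) sums hfun h z"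
      by (rule bounded_linear.sums[OF bounded_linear_hfun[OF z] h(1)])
    show "(\<lambda>n. hfun (hcoeff f n *\<^sub>C takenaka a n) z) sums
        (of_real (sqrt (1 - (norm a)\<^sup>2)) / (1 - cnj a * z) * hfun f (disk_aut a z))"
      using sums_mult[OF hfun_sums[OF disk_aut_norm[OF a z], of f],
          of "of_real (sqrt (1 - (norm a)\<^sup>2)) / (1 - cnj a * z)"]
      by (simp add: hfun_takenaka[OF a z] mult_ac)
  qed
  with h(2) show ?thesis by blast
qed

lemma W_op:
  assumes a: "norm a < 1"
  shows hfun_W_op: "norm z < 1 \<Longrightarrow> hfun (W_op a f) z
      = of_real (sqrt (1 - (norm a)\<^sup>2)) / (1 - cnj a * z) * hfun f (disk_aut a z)"
    and norm_W_op: "norm (W_op a f) = norm f"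
proof -
  obtain H where H: "\<And>f. norm (H f) = norm f"
    "\<And>f z. norm z < 1 \<Longrightarrow>
      hfun (H f) z = of_real (sqrt (1 - (norm a)\<^sup>2)) / (1 - cnj a * z) * hfun f (disk_aut a z)"
    using weighted_composition_exists[OF a] by metis
  have "bounded_linear H"
    by (rule bounded_linear_intro[where K = 1])
      (auto intro!: hardy_eqI_fun simp: H algebra_simps add_divide_distrib)
  moreover have "(\<lambda>f. hardy_of (\<lambda>z. complex_of_real (sqrt (1 - (norm a)\<^sup>2)) / (1 - cnj a * z)
      * hfun f (disk_aut a z))) = H"
    by (rule ext) (rule hardy_of_eqI, rule H(2))
  ultimately have "blinfun_apply (W_op a) = H"
    unfolding W_op_def by (simp only: bounded_linear_Blinfun_apply)
  then show "norm (W_op a f) = norm f" "norm z < 1 \<Longrightarrow> hfun (W_op a f) z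
      = of_real (sqrt (1 - (norm a)\<^sup>2)) / (1 - cnj a * z) * hfun f (disk_aut a z)"
    by (simp_all only: H)
qed

lemma clinear_W_op: "clinear_op (W_op a)" if "norm a < 1"
  unfolding clinear_op_def by (auto intro!: hardy_eqI_fun simp: hfun_W_op[OF that])

lemma W_op_involution: "W_op a o\<^sub>L W_op a = id_blinfun" if a: "norm a < 1"
proof (rule blinfun_eqI, rule hardy_eqI_fun)
  fix f and z :: complex assume z: "norm z < 1"
  let ?s = "complex_of_real (sqrt (1 - (norm a)\<^sup>2))"
  have "hfun ((W_op a o\<^sub>L W_op a) f) z
      = ?s * ?s / ((1 - cnj a * z) * (1 - cnj a * disk_aut a z)) * hfun f z"
    using hfun_W_op[OF a z, of "W_op a f"] hfun_W_op[OF a disk_aut_norm[OF a z], of f]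
    by (simp add: disk_aut_involution[OF a z])
  also have "\<dots> = hfun f z"
    unfolding of_real_sqrt_square[OF a] one_minus_disk_aut[OF a z]
    using one_minus_ne[OF a z] one_minus_norm_ne[OF a] by (simp del: of_real_power of_real_diff)
  finally show "hfun ((W_op a o\<^sub>L W_op a) f) z = hfun (id_blinfun f) z" by simp
qed

text \<open>For an isometry with \<open>W\<^sup>2 = I\<close>, \<open>\<langle>W f, g\<rangle> = \<langle>W f, W (W g)\<rangle> = \<langle>f, W g\<rangle>\<close>.\<close>

lemma is_adjoint_W_op: "is_adjoint (W_op a) (W_op a)" if a: "norm a < 1"
  unfolding is_adjoint_def
proof (intro allI)
  fix f g
  have "W_op a (W_op a g) = g"
    using arg_cong[OF W_op_involution[OF a], of "\<lambda>A. blinfun_apply A g"] by simp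
  then show "cinner (W_op a f) g = cinner f (W_op a g)"
    using isometry_cinner[OF clinear_W_op[OF a] norm_W_op[OF a], of f "W_op a g"] by simp
qed

text \<open>The multiplier \<open>1 - cnj a z\<close> cancels the denominator of the weight of \<open>W_op a\<close>.\<close>

lemma comp_op_factor:
  assumes a: "norm a < 1"
  shows "comp_op a = (1 / sqrt (1 - (norm a)\<^sup>2)) *\<^sub>R
    ((id_blinfun - op_scale (cnj a) shift) o\<^sub>L W_op a)" (is "_ = ?C")
proof -
  have s: "complex_of_real (sqrt (1 - (norm a)\<^sup>2)) \<noteq> 0"
    using a abs_square_less_1[of "norm a"] by simp
  have "hardy_of (\<lambda>z. hfun f (disk_aut a z)) = ?C f" for f
  proof (rule hardy_of_eqI)
    fix z :: complex assume z: "norm z < 1"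
    let ?s = "complex_of_real (sqrt (1 - (norm a)\<^sup>2))"
    have "hfun (?C f) z = 1 / ?s * ((1 - cnj a * z) * hfun (W_op a f) z)"
      by (simp add: blinfun.bilinear_simps hfun_shift[OF z] algebra_simps)
    also have "\<dots> = hfun f (disk_aut a z)"
      using s one_minus_ne[OF a z] by (simp add: hfun_W_op[OF a z])
    finally show "hfun (?C f) z = hfun f (disk_aut a z)" .
  qed
  then have "(\<lambda>f. hardy_of (\<lambda>z. hfun f (disk_aut a z))) = blinfun_apply ?C"
    by (rule ext)
  then show ?thesis
    by (simp only: comp_op_def blinfun_apply_inverse)
qed


section \<open>The absolute values and the polar decomposition\<close>

lemma op_pow_scaleR: "op_pow (c *\<^sub>R A) n = c ^ n *\<^sub>R op_pow A n"
  by (induction n) (simp_all add: compose_scaleR)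

lemma odd_prod_eq_gbinomial:
  "(\<Prod>k=1..n. real (2 * k - 1)) / fact n = ((-1/2) gchoose n) * (-2) ^ n"
proof -
  have "(\<Prod>k=1..n. real (2 * k - 1)) = (\<Prod>i=0..<n. -1/2 - real i) * (-2) ^ n"
    by (induction n) (simp_all add: of_nat_diff algebra_simps)
  then show ?thesis
    by (simp add: gbinomial_prod_rev)
qed

text \<open>The coefficients are those of the power series of \<open>(1 - 2 r x)\<^sup>-\<^sup>1\<^sup>/\<^sup>2\<close>.\<close>

lemma series_term_eq: "series_term r A n = ((-1/2) gchoose n) *\<^sub>R op_pow ((- 2 * r) *\<^sub>R A) n"
  unfolding series_term_def odd_prod_eq_gbinomial op_pow_scaleR power_mult_distrib
  by (simp add: mult.assoc)

lemma series_term_sums: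
  assumes "norm ((- 2 * r) *\<^sub>R A) < 1"
  shows "summable (\<lambda>n. series_term r A (Suc n))"
    and "id_blinfun + (\<Sum>n. series_term r A (Suc n)) = op_binomial (-1/2) ((- 2 * r) *\<^sub>R A)"
proof -
  have sums: "series_term r A sums op_binomial (-1/2) ((- 2 * r) *\<^sub>R A)"
    unfolding series_term_eq[abs_def] by (rule op_binomial_sums[OF assms])
  have zero: "series_term r A 0 = id_blinfun"
    by (simp add: series_term_def)
  show "summable (\<lambda>n. series_term r A (Suc n))"
    using sums_summable[OF sums] by (subst summable_Suc_iff)
  show "id_blinfun + (\<Sum>n. series_term r A (Suc n)) = op_binomial (-1/2) ((- 2 * r) *\<^sub>R A)"
    using suminf_split_head[OF sums_summable[OF sums]] sums_unique[OF sums] zero by simp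
qed

lemma Re_scaled_shift:
  assumes \<omega>: "norm \<omega> = 1" and T: "T = op_Re (op_scale (cnj \<omega>) shift)"
  shows Re_scaled_shift_eq: "T = (1/2) *\<^sub>R (op_scale (cnj \<omega>) shift + op_scale \<omega> backward_shift)"
    and is_adjoint_Re_scaled_shift: "is_adjoint T T"
    and clinear_Re_scaled_shift: "clinear_op T"
    and norm_Re_scaled_shift: "norm T \<le> 1"
proof -
  have adj: "is_adjoint (op_scale (cnj \<omega>) shift) (op_scale \<omega> backward_shift)"
    using is_adjoint_op_scale[OF is_adjoint_shift, of "cnj \<omega>"] by simp
  show eq: "T = (1/2) *\<^sub>R (op_scale (cnj \<omega>) shift + op_scale \<omega> backward_shift)"
    unfolding T op_Re_def adj_eqI[OF adj] ..
  have "is_adjoint T ((1/2) *\<^sub>R (op_scale \<omega> backward_shift + op_scale (cnj \<omega>) shift))"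
    unfolding eq by (intro is_adjoint_scaleR is_adjoint_add adj is_adjoint_sym[OF adj])
  then show "is_adjoint T T"
    by (simp add: eq add.commute)
  show "clinear_op T"
    unfolding eq by (intro clinear_scaleR clinear_add clinear_op_scale clinear_shift clinear_backward_shift)
  have "norm (op_scale (cnj \<omega>) shift + op_scale \<omega> backward_shift)
      \<le> norm (op_scale (cnj \<omega>) shift) + norm (op_scale \<omega> backward_shift)"
    by (rule norm_triangle_ineq)
  also have "\<dots> \<le> 1 + 1"
    using norm_op_scale_le[of "cnj \<omega>" shift] norm_op_scale_le[of \<omega> backward_shift]
      norm_shift_le norm_backward_shift_op_le \<omega> by simp
  finally show "norm T \<le> 1" by (simp add: eq)
qed

text \<open>This is \<open>L\<^sup>*L = (1 + \<bar>a\<bar>\<^sup>2) (I - 2 r T)\<close>, where \<open>S\<^sup>*S = I\<close> turns the product of the two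
  shift terms into the scalar \<open>\<bar>a\<bar>\<^sup>2\<close>. The choice of \<open>r\<close> gives \<open>(1 + \<bar>a\<bar>\<^sup>2) r = \<bar>a\<bar>\<close>.\<close>

lemma gram_one_minus_shift:
  fixes a \<omega> :: complex
  assumes \<omega>: "norm \<omega> = 1" "a = of_real (norm a) * \<omega>"
    and T: "T = op_Re (op_scale (cnj \<omega>) shift)"
    and r: "r = norm a / (1 + (norm a)\<^sup>2)"
  shows "(id_blinfun - op_scale a backward_shift) o\<^sub>L (id_blinfun - op_scale (cnj a) shift)
    = (1 + (norm a)\<^sup>2) *\<^sub>R (id_blinfun + (- 2 * r) *\<^sub>R T)"
proof (rule blinfun_eqI, rule hardy_eqI)
  fix f n
  define \<kappa> where "\<kappa> = 1 + (norm a)\<^sup>2"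
  define x s b where "x = hcoeff f n" "s = hcoeff (shift f) n" "b = hcoeff (backward_shift f) n"
  have "0 < \<kappa>" by (simp add: \<kappa>_def add_pos_nonneg)
  then have "\<kappa> * r = norm a" by (simp add: r flip: \<kappa>_def)
  then have kr: "of_real \<kappa> * of_real r = complex_of_real (norm a)"
    by (simp flip: of_real_mult)
  have ca: "cnj a = of_real (norm a) * cnj \<omega>"
    by (subst \<omega>(2)) simp
  have "hcoeff (((id_blinfun - op_scale a backward_shift) o\<^sub>L (id_blinfun - op_scale (cnj a) shift)) f) n
      = x - cnj a * s - a * b + (a * cnj a) * x"
    using clinear_backward_shift
    by (simp add: blinfun.bilinear_simps clinear_op_def x_s_b_def algebra_simps)
  also have "\<dots> = of_real \<kappa> * x - of_real (norm a) * (cnj \<omega> * s + \<omega> * b)"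
  proof -
    have ab: "a * b = of_real (norm a) * \<omega> * b"
      by (rule arg_cong[OF \<omega>(2), of "\<lambda>c. c * b"])
    then show ?thesis
      unfolding cnj_mult_self unfolding ca ab by (simp add: \<kappa>_def algebra_simps)
  qed
  also have "\<dots> = of_real \<kappa> * (x - of_real r * (cnj \<omega> * s + \<omega> * b))"
    by (simp add: algebra_simps flip: kr)
  also have "\<dots> = hcoeff (((1 + (norm a)\<^sup>2) *\<^sub>R (id_blinfun + (- 2 * r) *\<^sub>R T)) f) n"
    unfolding Re_scaled_shift_eq[OF \<omega>(1) T] \<kappa>_def[symmetric]
    by (simp add: blinfun.bilinear_simps x_s_b_def)
  finally show "hcoeff (((id_blinfun - op_scale a backward_shift)
      o\<^sub>L (id_blinfun - op_scale (cnj a) shift)) f) n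
    = hcoeff (((1 + (norm a)\<^sup>2) *\<^sub>R (id_blinfun + (- 2 * r) *\<^sub>R T)) f) n" .
qed

theorem lemma4p10:
  fixes a \<omega> :: complex and r :: real and T W L :: hop
  assumes a: "norm a < 1"
    and \<omega>: "norm \<omega> = 1" "a = complex_of_real (norm a) * \<omega>"
    and T: "T = op_Re (op_scale (cnj \<omega>) shift)"
    and r: "r = norm a / (1 + (norm a)\<^sup>2)"
    and W: "W = W_op a"
    and L: "L = id_blinfun - op_scale (cnj a) shift"
  shows
    "summable (\<lambda>n. series_term r T (Suc n))
     \<and> summable (\<lambda>n. series_term r (W o\<^sub>L T o\<^sub>L W) (Suc n))
     \<and> invertible_op (op_abs L)
     \<and> op_inv (op_abs L)
         = (1 / sqrt (1 + (norm a)\<^sup>2)) *\<^sub>R (id_blinfun + (\<Sum>n. series_term r T (Suc n)))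
     \<and> invertible_op (op_abs (comp_op a))
     \<and> op_inv (op_abs (comp_op a))
         = (sqrt (1 - (norm a)\<^sup>2) / sqrt (1 + (norm a)\<^sup>2)) *\<^sub>R
             (W o\<^sub>L (id_blinfun + (\<Sum>n. series_term r T (Suc n))) o\<^sub>L W)
     \<and> op_inv (op_abs (comp_op a))
         = (sqrt (1 - (norm a)\<^sup>2) / sqrt (1 + (norm a)\<^sup>2)) *\<^sub>R
             (id_blinfun + (\<Sum>n. series_term r (W o\<^sub>L T o\<^sub>L W) (Suc n)))
     \<and> rho a
         = (1 / sqrt (1 + (norm a)\<^sup>2)) *\<^sub>R
             (L o\<^sub>L (id_blinfun + (\<Sum>n. series_term r T (Suc n))) o\<^sub>L W)
     \<and> rho a = polar_part L o\<^sub>L W"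
proof -
  define X where "X = (- 2 * r) *\<^sub>R T"
  define \<kappa> \<sigma> where "\<kappa> = 1 + (norm a)\<^sup>2" "\<sigma> = 1 - (norm a)\<^sup>2"
  define G where "G = op_binomial (-1/2) X"
  define C where "C = comp_op a"
  have \<kappa>: "0 < \<kappa>" by (simp add: \<kappa>_\<sigma>_def add_pos_nonneg)
  have \<sigma>: "0 < \<sigma>" using a by (simp add: \<kappa>_\<sigma>_def abs_square_less_1)
  have WW: "W o\<^sub>L W = id_blinfun" unfolding W by (rule W_op_involution[OF a])
  have W_adj: "is_adjoint W W" unfolding W by (rule is_adjoint_W_op[OF a])
  have W_lin: "clinear_op W" unfolding W by (rule clinear_W_op[OF a])
  have W_norm: "norm W \<le> 1"
    unfolding W by (rule norm_blinfun_bound) (simp_all add: norm_W_op[OF a])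

  have "2 * r < 1"
  proof -
    have "0 < (1 - norm a)\<^sup>2" using a by simp
    then have "2 * norm a < \<kappa>" by (simp add: \<kappa>_\<sigma>_def power2_diff)
    then show ?thesis using \<kappa> by (simp add: r field_simps flip: \<kappa>_\<sigma>_def(1))
  qed
  moreover have "0 \<le> r" using \<kappa> by (simp add: r flip: \<kappa>_\<sigma>_def(1))
  ultimately have X_norm: "norm X < 1"
    using norm_Re_scaled_shift[OF \<omega>(1) T] mult_left_mono[of "norm T" 1 "2 * r"]
    by (simp add: X_def)
  have X_adj: "is_adjoint X X" and X_lin: "clinear_op X"
    unfolding X_def
    by (intro is_adjoint_scaleR is_adjoint_Re_scaled_shift[OF \<omega>(1) T]
        clinear_scaleR clinear_Re_scaled_shift[OF \<omega>(1) T])+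

  define Y where "Y = W o\<^sub>L X o\<^sub>L W"
  have Y_eq: "(- 2 * r) *\<^sub>R (W o\<^sub>L T o\<^sub>L W) = Y"
    unfolding Y_def X_def by (simp only: compose_scaleR)
  have "norm (Y f) \<le> norm X * norm f" for f
    unfolding Y_def using norm_blinfun[of X "W f"] by (simp add: W norm_W_op[OF a])
  then have Y_norm: "norm Y < 1"
    using norm_blinfun_bound[of "norm X" Y] X_norm by simp
  have Y_adj: "is_adjoint Y Y"
    using is_adjoint_compose[OF is_adjoint_compose[OF W_adj X_adj] W_adj]
    by (simp add: Y_def compose_assoc)
  have Y_lin: "clinear_op Y"
    unfolding Y_def by (intro clinear_compose W_lin X_lin)
  have GY: "op_binomial (-1/2) Y = W o\<^sub>L G o\<^sub>L W"
    unfolding Y_def G_def by (rule op_binomial_conj[OF WW X_norm Y_norm[unfolded Y_def]])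

  have serT: "summable (\<lambda>n. series_term r T (Suc n))"
    "id_blinfun + (\<Sum>n. series_term r T (Suc n)) = G"
    using series_term_sums[of r T, folded X_def, OF X_norm] by (simp_all add: G_def)
  have serW: "summable (\<lambda>n. series_term r (W o\<^sub>L T o\<^sub>L W) (Suc n))"
    "id_blinfun + (\<Sum>n. series_term r (W o\<^sub>L T o\<^sub>L W) (Suc n)) = W o\<^sub>L G o\<^sub>L W"
    using series_term_sums[of r "W o\<^sub>L T o\<^sub>L W", unfolded Y_eq, OF Y_norm] by (simp_all only: GY)

  have "is_adjoint L (id_blinfun - op_scale a backward_shift)"
    unfolding L using is_adjoint_op_scale[OF is_adjoint_shift, of "cnj a"]
    by (intro is_adjoint_diff is_adjoint_id) simp
  then have L_adj: "is_adjoint L (adj L)" and adjL: "adj L = id_blinfun - op_scale a backward_shift"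
    by (simp_all add: adj_eqI)
  have LL: "adj L o\<^sub>L L = \<kappa> *\<^sub>R (id_blinfun + X)"
    unfolding adjL unfolding L \<kappa>_\<sigma>_def X_def by (rule gram_one_minus_shift[OF \<omega> T r])
  note absL = op_abs_affine[OF X_lin X_adj X_norm \<kappa> LL]
  have invL: "op_inv (op_abs L) = (1 / sqrt \<kappa>) *\<^sub>R G"
    unfolding G_def by (rule op_inv_op_abs_affine[OF X_lin X_adj X_norm \<kappa> LL])

  have C_eq: "C = (1 / sqrt \<sigma>) *\<^sub>R (L o\<^sub>L W)"
    unfolding C_def L W \<kappa>_\<sigma>_def by (rule comp_op_factor[OF a])
  have "is_adjoint C ((1 / sqrt \<sigma>) *\<^sub>R (W o\<^sub>L adj L))"
    unfolding C_eq by (intro is_adjoint_scaleR is_adjoint_compose L_adj W_adj)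
  then have "adj C o\<^sub>L C = (1 / \<sigma>) *\<^sub>R (W o\<^sub>L (adj L o\<^sub>L L) o\<^sub>L W)"
    using \<sigma> by (simp add: adj_eqI C_eq compose_scaleR compose_assoc)
  also have "\<dots> = (\<kappa> / \<sigma>) *\<^sub>R ((W o\<^sub>L W) + Y)"
    unfolding LL Y_def by (rule blinfun_eqI) (simp add: blinfun.bilinear_simps)
  finally have CC: "adj C o\<^sub>L C = (\<kappa> / \<sigma>) *\<^sub>R (id_blinfun + Y)"
    by (simp only: WW)
  have \<kappa>\<sigma>: "0 < \<kappa> / \<sigma>" using \<kappa> \<sigma> by simp
  have invC: "op_inv (op_abs C) = (sqrt \<sigma> / sqrt \<kappa>) *\<^sub>R (W o\<^sub>L G o\<^sub>L W)"
    using op_inv_op_abs_affine[OF Y_lin Y_adj Y_norm \<kappa>\<sigma> CC] unfolding GY by (simp add: real_sqrt_divide)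

  have "rho a = C o\<^sub>L op_inv (op_abs C)"
    by (simp only: rho_def op_abs_def C_def)
  also have "\<dots> = (1 / sqrt \<kappa>) *\<^sub>R (L o\<^sub>L (W o\<^sub>L W) o\<^sub>L G o\<^sub>L W)"
    using \<sigma> unfolding invC unfolding C_eq by (simp add: compose_scaleR compose_assoc)
  finally have rho: "rho a = (1 / sqrt \<kappa>) *\<^sub>R (L o\<^sub>L G o\<^sub>L W)"
    by (simp add: WW)

  have "norm (L (op_inv (op_abs L) f)) = norm f" for f
  proof -
    have "norm (L (op_inv (op_abs L) f)) = norm ((op_abs L o\<^sub>L op_inv (op_abs L)) f)"
      using norm_op_abs[OF is_adjoint_op_abs_affine[OF X_lin X_adj X_norm \<kappa> LL]
          op_abs_affine_square[OF X_lin X_adj X_norm \<kappa> LL] L_adj] by simp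
    then show ?thesis by (simp add: absL(4))
  qed
  moreover have "clinear_op (L o\<^sub>L op_inv (op_abs L))"
    unfolding invL unfolding L G_def
    by (intro clinear_compose clinear_diff clinear_scaleR clinear_op_scale clinear_shift clinear_id
        op_binomial_clinear X_norm X_lin)
  ultimately have "polar_part L = L o\<^sub>L op_inv (op_abs L)"
    by (intro polar_part_invertible absL(4,5))
  then have polar: "polar_part L = (1 / sqrt \<kappa>) *\<^sub>R (L o\<^sub>L G)"
    by (simp add: invL compose_scaleR)

  show ?thesis
    unfolding serT(2) serW(2) \<kappa>_\<sigma>_def[symmetric] C_def[symmetric]
    using serT(1) serW(1) absL(2) invL invertible_op_abs_affine[OF Y_lin Y_adj Y_norm \<kappa>\<sigma> CC]
      invC rho
    by (simp add: polar compose_scaleR)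
qed

end
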